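(* Every finite positive two-person shortest path (SP) game has a Nash equilibrium in pure stationary strategies. Furthermore, such a Nash equilibrium can be computed in polynomial time.
   Context: A two-person SP game is given by a finite directed graph $G=(V,E)$ (loops, multiple arcs and directed cycles allowed), an initial vertex $s\in V$, a partition $V=V_1\cup V_2\cup V_T$ where $V_T$ is exactly the set of vertices with no outgoing arcs (terminals), and local cost functions $r_1,r_2:E\to\mathbb{R}$. The game is positive if $r_i(e)>0$ for all $i\in\{1,2\}$ and all $e\in E$. A (pure stationary) strategy $\sigma_i$ of player $i\in\{1,2\}$ assigns to each vertex $v\in V_i$ an arc $(v,\sigma_i(v))\in E$ leaving $v$. A situation $\sigma=(\sigma_1,\sigma_2)$ determines a unique play $p(\sigma)$: the walk starting at $s$ that at each $u\in V_i$ follows the arc chosen by $\sigma_i$, stopping when a terminal is reached; it is either a directed path from $s$ to $V_T$, or an $s$-lasso (a possibly empty path from $s$ followed by a directed cycle repeated forever). The effective cost of player $i$ is $R_i(p)=\sum_{e\in p}r_i(e)$ if $p$ is a path to $V_T$, and $R_i(p)=+\infty$ if $p$ is an $s$-lasso (in a positive game). Both players minimize their effective costs. A situation $\sigma$ is a Nash equilibrium (NE) if for each $i\in\{1,2\}$ and every situation $\sigma'$ differing from $\sigma$ only in the $i$-th strategy, $R_i(p(\sigma))\le R_i(p(\sigma'))$. *)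

theory Defs
  imports
    "Graph_Theory.Digraph"
    "HOL-Library.Extended_Real"
    "HOL-Computational_Algebra.Polynomial"
begin

section \<open>Two-person shortest path games\<close>

datatype player = P1 | P2

record ('v, 'e) sp_game =
  graph :: "('v, 'e) pre_digraph"
  init :: 'v
  ctrl :: "player \<Rightarrow> 'v set"
  cost :: "player \<Rightarrow> 'e \<Rightarrow> real"

definition terminals :: "('v, 'e) sp_game \<Rightarrow> 'v set" where
  "terminals G = {v \<in> verts (graph G). out_arcs (graph G) v = {}}"

text \<open>
  The locale \<^locale>\<open>fin_digraph\<close> allows loops and parallel arcs.
\<close>

definition sp_game :: "('v, 'e) sp_game \<Rightarrow> bool" where
  "sp_game G \<longleftrightarrow>
     fin_digraph (graph G) \<and>
     init G \<in> verts (graph G) \<and>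
     verts (graph G) = ctrl G P1 \<union> ctrl G P2 \<union> terminals G \<and>
     ctrl G P1 \<inter> ctrl G P2 = {} \<and>
     ctrl G P1 \<inter> terminals G = {} \<and>
     ctrl G P2 \<inter> terminals G = {}"

definition positive_sp_game :: "('v, 'e) sp_game \<Rightarrow> bool" where
  "positive_sp_game G \<longleftrightarrow>
     sp_game G \<and> (\<forall>i. \<forall>e \<in> arcs (graph G). cost G i e > 0)"

text \<open>
  A strategy is a total function on vertices, of which only the values on the vertices controlled
  by the player matter. Since there may be parallel arcs, it selects an arc, not a successor.
\<close>

definition strategy :: "('v, 'e) sp_game \<Rightarrow> player \<Rightarrow> ('v \<Rightarrow> 'e) \<Rightarrow> bool" where
  "strategy G i \<tau> \<longleftrightarrow> (\<forall>v \<in> ctrl G i. \<tau> v \<in> out_arcs (graph G) v)"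

definition situation :: "('v, 'e) sp_game \<Rightarrow> (player \<Rightarrow> 'v \<Rightarrow> 'e) \<Rightarrow> bool" where
  "situation G \<sigma> \<longleftrightarrow> (\<forall>i. strategy G i (\<sigma> i))"

definition chosen_arc :: "('v, 'e) sp_game \<Rightarrow> (player \<Rightarrow> 'v \<Rightarrow> 'e) \<Rightarrow> 'v \<Rightarrow> 'e" where
  "chosen_arc G \<sigma> v = (if v \<in> ctrl G P1 then \<sigma> P1 v else \<sigma> P2 v)"

text \<open>
  The vertices of the play. For convenience the sequence is continued as a constant one after
  a terminal has been reached.
\<close>

primrec play :: "('v, 'e) sp_game \<Rightarrow> (player \<Rightarrow> 'v \<Rightarrow> 'e) \<Rightarrow> nat \<Rightarrow> 'v" where
  "play G \<sigma> 0 = init G"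
| "play G \<sigma> (Suc k) =
     (let v = play G \<sigma> k
      in if v \<in> terminals G then v else head (graph G) (chosen_arc G \<sigma> v))"

definition terminating :: "('v, 'e) sp_game \<Rightarrow> (player \<Rightarrow> 'v \<Rightarrow> 'e) \<Rightarrow> bool" where
  "terminating G \<sigma> \<longleftrightarrow> (\<exists>k. play G \<sigma> k \<in> terminals G)"

text \<open>
  On a finite graph a play that never reaches a terminal is a lasso; the value \<open>\<infinity>\<close> assigned to
  it is the right one for positive games only.
\<close>

definition effective_cost ::
    "('v, 'e) sp_game \<Rightarrow> player \<Rightarrow> (player \<Rightarrow> 'v \<Rightarrow> 'e) \<Rightarrow> ereal" where
  "effective_cost G i \<sigma> =
     (if terminating G \<sigma>
      then ereal (\<Sum>k < (LEAST k. play G \<sigma> k \<in> terminals G).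
                    cost G i (chosen_arc G \<sigma> (play G \<sigma> k)))
      else \<infinity>)"

definition nash_equilibrium :: "('v, 'e) sp_game \<Rightarrow> (player \<Rightarrow> 'v \<Rightarrow> 'e) \<Rightarrow> bool" where
  "nash_equilibrium G \<sigma> \<longleftrightarrow>
     situation G \<sigma> \<and>
     (\<forall>i \<tau>. strategy G i \<tau> \<longrightarrow> effective_cost G i \<sigma> \<le> effective_cost G i (\<sigma>(i := \<tau>)))"


section \<open>Computation on an additive real random access machine\<close>

text \<open>
  Polynomial time is measured on a real RAM, presented as a structured programming language whose
  variables are arrays of natural numbers and arrays of reals. Every assignment and every test
  counts as one step; this is accurate up to a constant factor because the expressions of a fixed
  program have bounded size.

  The only arithmetic operations are addition, subtraction and comparison (there is no
  multiplication, no rounding, no conversion between the two kinds of data, and no real constant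
  other than 0). Hence on integral inputs (or rational ones over a common denominator) one step
  lengthens the binary representation of the numbers involved by a bounded amount only, and a
  number of steps that is polynomial on this machine means polynomial time on a Turing machine;
  for arbitrary real inputs it means a polynomial number of elementary operations.
\<close>

record store =
  nmem :: "nat \<Rightarrow> nat \<Rightarrow> nat"
  rmem :: "nat \<Rightarrow> nat \<Rightarrow> real"

datatype nexp =
    NConst nat
  | NRead nat nexp
  | NAdd nexp nexp
  | NSub nexp nexp

datatype rexp =
    RZero
  | RRead nat nexp
  | RAdd rexp rexp
  | RSub rexp rexp

datatype bexp =
    NLess nexp nexp
  | RLess rexp rexp
  | BNot bexp
  | BAnd bexp bexp

datatype com =
    Skip
  | NAssign nat nexp nexp
  | RAssign nat nexp rexp
  | Seq com com
  | Cond bexp com com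
  | While bexp com

primrec nval :: "nexp \<Rightarrow> store \<Rightarrow> nat" where
  "nval (NConst c) s = c"
| "nval (NRead a x) s = nmem s a (nval x s)"
| "nval (NAdd x y) s = nval x s + nval y s"
| "nval (NSub x y) s = nval x s - nval y s"

primrec rval :: "rexp \<Rightarrow> store \<Rightarrow> real" where
  "rval RZero s = 0"
| "rval (RRead a x) s = rmem s a (nval x s)"
| "rval (RAdd x y) s = rval x s + rval y s"
| "rval (RSub x y) s = rval x s - rval y s"

primrec bval :: "bexp \<Rightarrow> store \<Rightarrow> bool" where
  "bval (NLess x y) s \<longleftrightarrow> nval x s < nval y s"
| "bval (RLess x y) s \<longleftrightarrow> rval x s < rval y s"
| "bval (BNot b) s \<longleftrightarrow> \<not> bval b s"
| "bval (BAnd b b') s \<longleftrightarrow> bval b s \<and> bval b' s"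

definition nwrite :: "nat \<Rightarrow> nat \<Rightarrow> nat \<Rightarrow> store \<Rightarrow> store" where
  "nwrite a j x s = s\<lparr>nmem := (nmem s)(a := (nmem s a)(j := x))\<rparr>"

definition rwrite :: "nat \<Rightarrow> nat \<Rightarrow> real \<Rightarrow> store \<Rightarrow> store" where
  "rwrite a j x s = s\<lparr>rmem := (rmem s)(a := (rmem s a)(j := x))\<rparr>"

text \<open>
  \<open>exec c s t s'\<close>: started in store \<open>s\<close>, the program \<open>c\<close> halts after \<open>t\<close> steps in store \<open>s'\<close>.
\<close>

inductive exec :: "com \<Rightarrow> store \<Rightarrow> nat \<Rightarrow> store \<Rightarrow> bool" where
  Skip: "exec Skip s 1 s"
| NAssign: "exec (NAssign a x y) s 1 (nwrite a (nval x s) (nval y s) s)"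
| RAssign: "exec (RAssign a x y) s 1 (rwrite a (nval x s) (rval y s) s)"
| Seq: "exec c s t s' \<Longrightarrow> exec c' s' t' s'' \<Longrightarrow> exec (Seq c c') s (t + t') s''"
| CondTrue: "bval b s \<Longrightarrow> exec c s t s' \<Longrightarrow> exec (Cond b c c') s (Suc t) s'"
| CondFalse: "\<not> bval b s \<Longrightarrow> exec c' s t s' \<Longrightarrow> exec (Cond b c c') s (Suc t) s'"
| WhileFalse: "\<not> bval b s \<Longrightarrow> exec (While b c) s 1 s"
| WhileTrue: "bval b s \<Longrightarrow> exec c s t s' \<Longrightarrow> exec (While b c) s' t' s'' \<Longrightarrow>
    exec (While b c) s (Suc (t + t')) s''"

text \<open>
  A search problem is given by its instances, their sizes, the store holding an instance as input,
  and the relation telling which final stores hold a correct output. One program and one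
  polynomial have to serve all instances.
\<close>

definition poly_time_solvable ::
    "'a set \<Rightarrow> ('a \<Rightarrow> nat) \<Rightarrow> ('a \<Rightarrow> store) \<Rightarrow> ('a \<Rightarrow> store \<Rightarrow> bool) \<Rightarrow> bool" where
  "poly_time_solvable I sz input correct \<longleftrightarrow>
     (\<exists>c. \<exists>p :: nat poly. \<forall>x \<in> I. \<exists>t s.
        exec c (input x) t s \<and> t \<le> poly p (sz x) \<and> correct x s)"


section \<open>Games as inputs and situations as outputs\<close>

text \<open>
  As inputs, games have vertices \<open>0, \<dots>, n - 1\<close> and arcs \<open>0, \<dots>, m - 1\<close>; every finite game is
  isomorphic to one of this form.
\<close>

definition numbered :: "(nat, nat) sp_game \<Rightarrow> bool" where
  "numbered G \<longleftrightarrow>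
     verts (graph G) = {..<card (verts (graph G))} \<and>
     arcs (graph G) = {..<card (arcs (graph G))}"

definition game_size :: "('v, 'e) sp_game \<Rightarrow> nat" where
  "game_size G = card (verts (graph G)) + card (arcs (graph G))"

text \<open>
  Input arrays of naturals: 0 holds the number of vertices, the number of arcs and the initial
  vertex; 1 holds for each vertex the player controlling it, or 0 for a terminal; 2 and 3 hold the
  tails and heads of the arcs. Input arrays of reals: 0 and 1 hold the local costs of the two
  players. All the rest of the memory is 0; in particular nothing is leaked from the values of the
  functions in the record outside the vertices and arcs. On output the array 4 of naturals holds
  the arcs chosen at the nonterminal vertices; no separate arrays for the two players are needed
  since they control disjoint sets of vertices.
\<close>

definition game_input :: "(nat, nat) sp_game \<Rightarrow> store" where
  "game_input G =
    (let n = card (verts (graph G)); m = card (arcs (graph G)) in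
     \<lparr>nmem = (\<lambda>a j.
        if a = 0 then (if j = 0 then n else if j = 1 then m else if j = 2 then init G else 0)
        else if a = 1 \<and> j < n then
          (if j \<in> ctrl G P1 then 1 else if j \<in> ctrl G P2 then 2 else 0)
        else if a = 2 \<and> j < m then tail (graph G) j
        else if a = 3 \<and> j < m then head (graph G) j
        else 0),
      rmem = (\<lambda>a j.
        if a = 0 \<and> j < m then cost G P1 j
        else if a = 1 \<and> j < m then cost G P2 j
        else 0)\<rparr>)"

definition output_situation :: "store \<Rightarrow> player \<Rightarrow> nat \<Rightarrow> nat" where
  "output_situation s i v = nmem s 4 v"

end

theory Submission
  imports Defs
begin

text \<open>
  For each player \<open>i\<close>, consider the zero-sum game in which player \<open>i\<close> minimizes the own cost and
  the opponent maximizes it, with all values cut off at \<open>cap G i\<close>, twice the sum of all local costs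
  of player \<open>i\<close>; since positive costs exclude cycles, value iteration becomes stationary after as
  many rounds as there are vertices. A value below the cap at the initial vertex means that
  player \<open>i\<close> can force termination.

  If neither player can, each of them blocks the other, and all plays are infinite even after a
  deviation. If player \<open>q\<close> can, let \<open>q\<close> play optimally in the zero-sum game and let the opponent
  answer with a shortest path \<open>P\<close> with respect to the opponent's own costs, switching to the
  strategy that maximizes the cost of \<open>q\<close> outside \<open>P\<close>. Between two vertices of \<open>P\<close>, the cost of
  \<open>q\<close> along \<open>P\<close> is at most the difference of the values, whereas the cost of a detour is at
  least this difference. Hence \<open>q\<close> has no reason to deviate either.
\<close>

section \<open>Existence of equilibria\<close>

text \<open>The cutoff keeps values real where the maximizer can force an infinite play. It is twice
  the sum because a path may use every arc: its cost can equal the plain sum, and value at the cap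
  would then no longer separate blocking from termination. The doubling is written as an addition
  since the machine cannot multiply.

  The arc set \<open>E\<close> is a parameter so that one iteration does two jobs. With all arcs it
  gives the zero-sum values. With the arcs of \<open>q\<close> fixed, the maximizer has a single arc
  at each vertex, and the values for the opponent of \<open>q\<close> are shortest distances, cut
  off at the cap.

  What is used of \<open>game_value\<close> is the fixpoint equation, the bounds \<open>0\<close>
  and \<open>cap G i\<close>, and the value 0 at terminals; arcs only have to satisfy the resulting
  inequalities (\<open>greedy\<close>). Below the cap, positive costs make the value drop strictly
  along the minimizer's greedy arcs, so ties cannot create cycles. Hence the two sufficient
  conditions for an equilibrium serve both arcs obtained by choice and arcs found by the program,
  however it breaks ties.\<close>

definition opponent :: "player \<Rightarrow> player" where
  "opponent i = (case i of P1 \<Rightarrow> P2 | P2 \<Rightarrow> P1)"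

definition cap :: "('v, 'e) sp_game \<Rightarrow> player \<Rightarrow> real" where
  "cap G i = (\<Sum>e \<in> arcs (graph G). cost G i e + cost G i e)"

definition arc_value :: "('v, 'e) sp_game \<Rightarrow> player \<Rightarrow> ('v \<Rightarrow> real) \<Rightarrow> 'e \<Rightarrow> real" where
  "arc_value G i w e = cost G i e + w (head (graph G) e)"

text \<open>The inserted \<open>cap G i\<close> and \<open>0\<close> make both sets nonempty and are
  the starting values of a running minimum or maximum over the arcs. The former is the cutoff at
  vertices of \<open>i\<close>; the latter gives terminals, which have no arc, the value 0.\<close>

definition bellman ::
    "('v, 'e) sp_game \<Rightarrow> player \<Rightarrow> 'e set \<Rightarrow> ('v \<Rightarrow> real) \<Rightarrow> 'v \<Rightarrow> real" where
  "bellman G i E w x =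
     (if x \<in> ctrl G i
      then Min (insert (cap G i) (arc_value G i w ` {e \<in> E. tail (graph G) e = x}))
      else Max (insert 0 ((\<lambda>e. min (cap G i) (arc_value G i w e)) ` {e \<in> E. tail (graph G) e = x})))"

primrec value_iter ::
    "('v, 'e) sp_game \<Rightarrow> player \<Rightarrow> 'e set \<Rightarrow> nat \<Rightarrow> 'v \<Rightarrow> real" where
  "value_iter G i E 0 = (\<lambda>x. if x \<in> terminals G then 0 else cap G i)"
| "value_iter G i E (Suc k) = bellman G i E (value_iter G i E k)"

definition game_value :: "('v, 'e) sp_game \<Rightarrow> player \<Rightarrow> 'e set \<Rightarrow> 'v \<Rightarrow> real" where
  "game_value G i E = value_iter G i E (card (verts (graph G)))"

definition admissible :: "('v, 'e) sp_game \<Rightarrow> 'e set \<Rightarrow> bool" where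
  "admissible G E \<longleftrightarrow>
     E \<subseteq> arcs (graph G) \<and> (\<forall>x \<in> verts (graph G) - terminals G. \<exists>e \<in> E. tail (graph G) e = x)"

text \<open>One function serves both sides: optimal arcs of \<open>i\<close> at the vertices of
  \<open>i\<close>, maximizing arcs of the opponent elsewhere. At a vertex of \<open>i\<close> with
  value \<open>cap G i\<close> the minimum may come from the inserted cap alone, so any arc of
  \<open>E\<close> is accepted there.\<close>

definition greedy ::
    "('v, 'e) sp_game \<Rightarrow> player \<Rightarrow> 'e set \<Rightarrow> ('v \<Rightarrow> real) \<Rightarrow> ('v \<Rightarrow> 'e) \<Rightarrow> bool" where
  "greedy G i E w a \<longleftrightarrow>
     (\<forall>x \<in> verts (graph G) - terminals G. a x \<in> E \<and> tail (graph G) (a x) = x \<and>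
        (if x \<in> ctrl G i then w x < cap G i \<longrightarrow> arc_value G i w (a x) \<le> w x
         else w x \<le> arc_value G i w (a x)))"

definition spent ::
    "('v, 'e) sp_game \<Rightarrow> player \<Rightarrow> (player \<Rightarrow> 'v \<Rightarrow> 'e) \<Rightarrow> nat \<Rightarrow> real" where
  "spent G i \<sigma> j = (\<Sum>k<j. cost G i (chosen_arc G \<sigma> (play G \<sigma> k)))"

locale positive_game =
  fixes G :: "('v, 'e) sp_game"
  assumes positive: "positive_sp_game G"
begin

sublocale fin_digraph "graph G"
  using positive by (auto simp: positive_sp_game_def sp_game_def)

lemma init_vert: "init G \<in> verts (graph G)"
  using positive by (auto simp: positive_sp_game_def sp_game_def)

lemma cost_pos: "e \<in> arcs (graph G) \<Longrightarrow> 0 < cost G i e"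
  using positive by (auto simp: positive_sp_game_def)

lemma ctrl_cases:
  assumes "x \<in> verts (graph G)" "x \<notin> terminals G"
  obtains "x \<in> ctrl G i" "x \<notin> ctrl G (opponent i)" | "x \<in> ctrl G (opponent i)" "x \<notin> ctrl G i"
  using assms positive
  by (cases i) (auto simp: positive_sp_game_def sp_game_def opponent_def)

lemma ctrl_vert: "x \<in> ctrl G i \<Longrightarrow> x \<in> verts (graph G) - terminals G"
  using positive by (cases i) (auto simp: positive_sp_game_def sp_game_def)

lemma ctrl_opponent: "x \<in> ctrl G (opponent i) \<Longrightarrow> x \<notin> ctrl G i"
  using positive by (cases i) (auto simp: positive_sp_game_def sp_game_def opponent_def)

lemma terminal_no_arc: "e \<in> arcs (graph G) \<Longrightarrow> tail (graph G) e \<notin> terminals G"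
  by (auto simp: terminals_def out_arcs_def)

lemma cap_nonneg: "0 \<le> cap G i"
  unfolding cap_def by (intro sum_nonneg) (simp add: cost_pos less_imp_le)

lemma cap_eq: "cap G i = 2 * (\<Sum>e \<in> arcs (graph G). cost G i e)"
  unfolding cap_def by (simp only: sum.distrib mult_2)

lemma sum_less_cap:
  assumes "x \<in> verts (graph G)" "x \<notin> terminals G"
  shows "(\<Sum>e \<in> arcs (graph G). cost G i e) < cap G i"
proof -
  have "arcs (graph G) \<noteq> {}"
    using assms by (auto simp: terminals_def)
  then have "0 < (\<Sum>e \<in> arcs (graph G). cost G i e)"
    by (intro sum_pos) (auto simp: cost_pos)
  then show ?thesis by (simp add: cap_eq)
qed


subsection \<open>Value iteration\<close>

context
  fixes i :: player and E :: "'e set"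
  assumes E: "E \<subseteq> arcs (graph G)"
begin

lemma finite_E: "finite {e \<in> E. P e}"
  using E finite_arcs by (metis (no_types, lifting) finite_subset mem_Collect_eq subsetI subset_trans)

lemma bellman_le_arc:
  "x \<in> ctrl G i \<Longrightarrow> e \<in> E \<Longrightarrow> tail (graph G) e = x \<Longrightarrow> bellman G i E w x \<le> arc_value G i w e"
  unfolding bellman_def using finite_E by (auto intro!: Min_le)

lemma bellman_min_attained:
  assumes "x \<in> ctrl G i"
  shows "bellman G i E w x = cap G i \<or>
    (\<exists>e \<in> E. tail (graph G) e = x \<and> bellman G i E w x = arc_value G i w e)"
proof -
  let ?M = "insert (cap G i) (arc_value G i w ` {e \<in> E. tail (graph G) e = x})"
  have "Min ?M \<in> ?M" using finite_E by (intro Min_in) auto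
  then show ?thesis using assms by (auto simp: bellman_def)
qed

lemma bellman_ge_arc:
  "x \<notin> ctrl G i \<Longrightarrow> e \<in> E \<Longrightarrow> tail (graph G) e = x \<Longrightarrow>
   min (cap G i) (arc_value G i w e) \<le> bellman G i E w x"
  unfolding bellman_def using finite_E by (auto intro!: Max_ge simp del: Max_insert)

lemma bellman_max_attained:
  assumes "x \<notin> ctrl G i"
  shows "bellman G i E w x = 0 \<or>
    (\<exists>e \<in> E. tail (graph G) e = x \<and> bellman G i E w x = min (cap G i) (arc_value G i w e))"
proof -
  let ?M = "insert 0 ((\<lambda>e. min (cap G i) (arc_value G i w e)) ` {e \<in> E. tail (graph G) e = x})"
  have "Max ?M \<in> ?M" using finite_E by (intro Max_in) auto
  then show ?thesis using assms by (auto simp: bellman_def)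
qed

lemma bellman_le_cap: "bellman G i E w x \<le> cap G i"
proof (cases "x \<in> ctrl G i")
  case True
  then show ?thesis unfolding bellman_def using finite_E by (auto intro!: Min_le simp del: Min_insert)
next
  case False
  then show ?thesis using bellman_max_attained[OF False, of w] cap_nonneg[of i] by auto
qed

lemma arc_value_pos: "e \<in> E \<Longrightarrow> (\<And>y. 0 \<le> w y) \<Longrightarrow> 0 < arc_value G i w e"
  unfolding arc_value_def using E cost_pos[of e i] by (smt (verit) subsetD)

lemma bellman_nonneg:
  assumes "\<And>y. 0 \<le> w y"
  shows "0 \<le> bellman G i E w x"
proof (cases "x \<in> ctrl G i")
  case True
  have "0 \<le> arc_value G i w e" if "e \<in> E" for e using arc_value_pos[OF that, of w] assms by simp
  then show ?thesis using bellman_min_attained[OF True, of w] cap_nonneg[of i] by auto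
next
  case False
  then show ?thesis using finite_E by (simp add: bellman_def del: Max_insert)
qed

lemma bellman_mono:
  assumes "\<And>y. w y \<le> w' y"
  shows "bellman G i E w x \<le> bellman G i E w' x"
proof -
  have le: "arc_value G i w e \<le> arc_value G i w' e" for e
    using assms by (simp add: arc_value_def)
  show ?thesis
  proof (cases "x \<in> ctrl G i")
    case True
    have "bellman G i E w x \<le> arc_value G i w' e" if "e \<in> E" "tail (graph G) e = x" for e
      using bellman_le_arc[OF True that, of w] le[of e] by linarith
    then show ?thesis
      using bellman_min_attained[OF True, of w'] bellman_le_cap[of w x] by auto
  next
    case False
    have "0 \<le> bellman G i E w' x"
      using False finite_E by (simp add: bellman_def del: Max_insert)
    moreover have "min (cap G i) (arc_value G i w e) \<le> bellman G i E w' x"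
      if "e \<in> E" "tail (graph G) e = x" for e
      using bellman_ge_arc[OF False that, of w'] le[of e] by linarith
    ultimately show ?thesis
      using bellman_max_attained[OF False, of w] by auto
  qed
qed

lemma bellman_terminal: "x \<in> terminals G \<Longrightarrow> bellman G i E w x = 0"
proof -
  assume x: "x \<in> terminals G"
  then have "{e \<in> E. tail (graph G) e = x} = {}" using E terminal_no_arc by auto
  moreover have "x \<notin> ctrl G i" using x ctrl_vert by auto
  ultimately show ?thesis unfolding bellman_def by (simp only: image_empty Max_singleton if_False)
qed

lemma value_iter_nonneg: "0 \<le> value_iter G i E k x"
  by (induction k arbitrary: x) (auto simp: cap_nonneg bellman_nonneg)

lemma value_iter_le_cap: "value_iter G i E k x \<le> cap G i"
  by (cases k) (auto simp: cap_nonneg bellman_le_cap)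

text \<open>The iteration starts at the cap off the terminals, which \<open>bellman\<close> never
  exceeds; monotonicity passes the first decrease on to all rounds.\<close>

lemma value_iter_decreasing: "value_iter G i E (Suc k) x \<le> value_iter G i E k x"
proof (induction k arbitrary: x)
  case 0
  then show ?case by (simp add: bellman_terminal bellman_le_cap)
next
  case (Suc k)
  then show ?case using bellman_mono[of "value_iter G i E (Suc k)" "value_iter G i E k" x] by simp
qed

text \<open>
  The vertices witnessing that the value still decreases in round \<open>k\<close> form a walk along which the
  new values strictly increase, whence they are distinct.
\<close>
lemma value_iter_progress:
  assumes "x \<in> verts (graph G)" "value_iter G i E (Suc k) x < value_iter G i E k x"
  shows "\<exists>S \<subseteq> verts (graph G). card S = Suc k \<and>
    (\<forall>y \<in> S. value_iter G i E (Suc k) y \<le> value_iter G i E (Suc k) x)"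
  using assms
proof (induction k arbitrary: x)
  case 0
  show ?case by (rule exI[of _ "{x}"]) (use 0 in auto)
next
  case (Suc k)
  let ?u = "value_iter G i E"
  \<comment> \<open>The next vertex is the head of an arc: at a vertex of \<open>i\<close> the arc
    attaining the newer minimum, elsewhere the arc attaining the older maximum. Comparing both
    rounds on this same arc transfers the strict decrease to its head, and its positive cost makes
    the value there strictly smaller.\<close>
  have "\<exists>y \<in> verts (graph G). ?u (Suc k) y < ?u k y \<and> ?u (Suc k) y < ?u (Suc (Suc k)) x"
  proof (cases "x \<in> ctrl G i")
    case True
    have "?u (Suc (Suc k)) x < cap G i" using Suc.prems value_iter_le_cap[of "Suc k" x] by linarith
    then obtain e where e: "e \<in> E" "tail (graph G) e = x"
      "?u (Suc (Suc k)) x = arc_value G i (?u (Suc k)) e"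
      using bellman_min_attained[OF True, of "?u (Suc k)"] by auto
    have "?u (Suc k) x \<le> arc_value G i (?u k) e"
      using bellman_le_arc[OF True e(1,2), of "?u k"] by simp
    moreover have "e \<in> arcs (graph G)" using e E by auto
    ultimately show ?thesis
      using e(3) Suc.prems(2) cost_pos[of e i]
      by (intro bexI[of _ "head (graph G) e"]) (auto simp: arc_value_def simp del: value_iter.simps)
  next
    case False
    have "0 < ?u (Suc k) x" using Suc.prems value_iter_nonneg[of "Suc (Suc k)" x] by linarith
    then obtain e where e: "e \<in> E" "tail (graph G) e = x"
      "?u (Suc k) x = min (cap G i) (arc_value G i (?u k) e)"
      using bellman_max_attained[OF False, of "?u k"] by auto
    have "min (cap G i) (arc_value G i (?u (Suc k)) e) \<le> ?u (Suc (Suc k)) x"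
      using bellman_ge_arc[OF False e(1,2), of "?u (Suc k)"] by simp
    moreover have "e \<in> arcs (graph G)" using e E by auto
    ultimately show ?thesis
      using e(3) Suc.prems(2) cost_pos[of e i]
      by (intro bexI[of _ "head (graph G) e"])
        (auto simp: arc_value_def min_def simp del: value_iter.simps split: if_splits)
  qed
  then obtain y where y: "y \<in> verts (graph G)" "?u (Suc k) y < ?u k y"
    "?u (Suc k) y < ?u (Suc (Suc k)) x" by auto
  from Suc.IH[OF y(1,2)] obtain S where S: "S \<subseteq> verts (graph G)" "card S = Suc k"
    "\<forall>z \<in> S. ?u (Suc k) z \<le> ?u (Suc k) y" by auto
  have less: "?u (Suc (Suc k)) z < ?u (Suc (Suc k)) x" if "z \<in> S" for z
    using S(3) that y(3) value_iter_decreasing[of "Suc k" z] by force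
  then have "x \<notin> S" by blast
  moreover have "finite S" using S(2) by (metis card.infinite nat.distinct(1))
  ultimately show ?case
    using S(1,2) less Suc.prems(1) by (intro exI[of _ "insert x S"]) (auto simp del: value_iter.simps intro: less_imp_le)
qed

text \<open>A further decrease after as many rounds as there are vertices would exhibit one vertex
  too many.\<close>

lemma game_value_fixpoint:
  assumes "x \<in> verts (graph G)"
  shows "bellman G i E (game_value G i E) x = game_value G i E x"
proof (rule ccontr)
  let ?n = "card (verts (graph G))"
  assume "bellman G i E (game_value G i E) x \<noteq> game_value G i E x"
  then have "value_iter G i E (Suc ?n) x < value_iter G i E ?n x"
    using value_iter_decreasing[of ?n x] unfolding game_value_def value_iter.simps by linarith
  from value_iter_progress[OF assms this] obtain S where
    "S \<subseteq> verts (graph G)" "card S = Suc ?n" by blast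
  then show False using card_mono[OF finite_verts, of S] by linarith
qed

lemma game_value_nonneg: "0 \<le> game_value G i E x"
  by (simp add: game_value_def value_iter_nonneg)

lemma game_value_le_cap: "game_value G i E x \<le> cap G i"
  by (simp add: game_value_def value_iter_le_cap)

lemma game_value_terminal: "x \<in> terminals G \<Longrightarrow> game_value G i E x = 0"
  using bellman_terminal[of x "game_value G i E"] game_value_fixpoint[of x] by (simp add: terminals_def)

lemma game_value_le_arc:
  "x \<in> ctrl G i \<Longrightarrow> e \<in> E \<Longrightarrow> tail (graph G) e = x \<Longrightarrow>
   game_value G i E x \<le> arc_value G i (game_value G i E) e"
  using bellman_le_arc[of x e "game_value G i E"] ctrl_vert[of x i] game_value_fixpoint[of x] by simp

lemma game_value_ge_arc:
  assumes "e \<in> E" "tail (graph G) e = x" "x \<notin> ctrl G i" "game_value G i E x < cap G i"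
  shows "arc_value G i (game_value G i E) e \<le> game_value G i E x"
proof -
  have "x \<in> verts (graph G)" using assms(1,2) E by auto
  then have "min (cap G i) (arc_value G i (game_value G i E) e) \<le> game_value G i E x"
    using bellman_ge_arc[OF assms(3,1,2), of "game_value G i E"] game_value_fixpoint[of x] by simp
  then show ?thesis using assms(4) by linarith
qed

lemma ex_greedy_arc:
  assumes "admissible G E" "x \<in> verts (graph G) - terminals G"
  shows "\<exists>e \<in> E. tail (graph G) e = x \<and>
    (if x \<in> ctrl G i then game_value G i E x < cap G i \<longrightarrow> arc_value G i (game_value G i E) e \<le> game_value G i E x
     else game_value G i E x \<le> arc_value G i (game_value G i E) e)"
proof -
  let ?v = "game_value G i E"
  have fp: "bellman G i E ?v x = ?v x" by (rule game_value_fixpoint) (rule DiffD1[OF assms(2)])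
  obtain e0 where e0: "e0 \<in> E" "tail (graph G) e0 = x"
    using assms unfolding admissible_def by blast
  show ?thesis
  proof (cases "x \<in> ctrl G i")
    case True
    have "?v x = cap G i \<or> (\<exists>e \<in> E. tail (graph G) e = x \<and> ?v x = arc_value G i ?v e)"
      using bellman_min_attained[OF True, of ?v] unfolding fp .
    then show ?thesis
    proof
      assume "?v x = cap G i"
      then show ?thesis using True e0 by (intro bexI[of _ e0]) simp_all
    next
      assume "\<exists>e \<in> E. tail (graph G) e = x \<and> ?v x = arc_value G i ?v e"
      then obtain e where "e \<in> E" "tail (graph G) e = x" "?v x = arc_value G i ?v e" by blast
      then show ?thesis by (intro bexI[of _ e]) simp_all
    qed
  next
    case False
    have "?v x = 0 \<or> (\<exists>e \<in> E. tail (graph G) e = x \<and> ?v x = min (cap G i) (arc_value G i ?v e))"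
      using bellman_max_attained[OF False, of ?v] unfolding fp .
    then show ?thesis
    proof
      \<comment> \<open>The maximum may be the inserted 0, but arc values are positive, so every arc
        of \<open>E\<close> at \<open>x\<close> qualifies.\<close>
      assume "?v x = 0"
      then show ?thesis
        using False e0 arc_value_pos[OF e0(1), of ?v] game_value_nonneg
        by (intro bexI[of _ e0]) simp_all
    next
      assume "\<exists>e \<in> E. tail (graph G) e = x \<and> ?v x = min (cap G i) (arc_value G i ?v e)"
      then obtain e where "e \<in> E" "tail (graph G) e = x" "?v x = min (cap G i) (arc_value G i ?v e)"
        by blast
      then show ?thesis using False by (intro bexI[of _ e]) simp_all
    qed
  qed
qed

lemma ex_greedy:
  assumes "admissible G E"
  shows "\<exists>a. greedy G i E (game_value G i E) a"
proof -
  have "\<forall>x \<in> verts (graph G) - terminals G. \<exists>e. e \<in> E \<and> tail (graph G) e = x \<and>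
    (if x \<in> ctrl G i then game_value G i E x < cap G i \<longrightarrow> arc_value G i (game_value G i E) e \<le> game_value G i E x
     else game_value G i E x \<le> arc_value G i (game_value G i E) e)"
    using ex_greedy_arc[OF assms] by blast
  from bchoice[OF this] show ?thesis unfolding greedy_def by blast
qed

end


subsection \<open>Plays\<close>

lemma chosen_arc_ctrl: "x \<in> ctrl G i \<Longrightarrow> chosen_arc G \<sigma> x = \<sigma> i x"
  using ctrl_opponent[of x i] by (cases i) (auto simp: chosen_arc_def opponent_def)

lemma chosen_arc_out:
  assumes "situation G \<sigma>" "x \<in> verts (graph G)" "x \<notin> terminals G"
  shows "chosen_arc G \<sigma> x \<in> arcs (graph G)" "tail (graph G) (chosen_arc G \<sigma> x) = x"
proof -
  have "chosen_arc G \<sigma> x \<in> out_arcs (graph G) x"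
    using assms(2,3)
    by (rule ctrl_cases[where i = P1])
      (use assms(1) in \<open>auto simp: situation_def strategy_def chosen_arc_def opponent_def\<close>)
  then show "chosen_arc G \<sigma> x \<in> arcs (graph G)" "tail (graph G) (chosen_arc G \<sigma> x) = x"
    by (auto simp: out_arcs_def)
qed

lemma play_vert:
  assumes "situation G \<sigma>"
  shows "play G \<sigma> k \<in> verts (graph G)"
proof (induction k)
  case (Suc k)
  then show ?case using chosen_arc_out(1)[OF assms Suc] by (simp add: Let_def)
qed (simp add: init_vert)

lemma play_step:
  "play G \<sigma> k \<notin> terminals G \<Longrightarrow> play G \<sigma> (Suc k) = head (graph G) (chosen_arc G \<sigma> (play G \<sigma> k))"
  by (simp add: Let_def)

lemma play_terminal_stays:
  assumes "play G \<sigma> k \<in> terminals G" "k \<le> j"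
  shows "play G \<sigma> j = play G \<sigma> k"
  using assms(2)
proof (induction j rule: dec_induct)
  case (step j)
  then show ?case using assms(1) by (simp add: Let_def)
qed simp

lemma terminating_cases:
  assumes "terminating G \<sigma>"
  obtains K where "play G \<sigma> K \<in> terminals G" "\<And>k. k < K \<Longrightarrow> play G \<sigma> k \<notin> terminals G"
    "\<And>i. effective_cost G i \<sigma> = ereal (spent G i \<sigma> K)"
proof
  let ?K = "LEAST k. play G \<sigma> k \<in> terminals G"
  show "play G \<sigma> ?K \<in> terminals G"
    using assms LeastI_ex[of "\<lambda>k. play G \<sigma> k \<in> terminals G"] by (auto simp: terminating_def)
  show "play G \<sigma> k \<notin> terminals G" if "k < ?K" for k
    using not_less_Least[OF that] .
  show "effective_cost G i \<sigma> = ereal (spent G i \<sigma> ?K)" for i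
    using assms by (simp add: effective_cost_def spent_def)
qed

lemma play_period: "play G \<sigma> i = play G \<sigma> j \<Longrightarrow> play G \<sigma> (i + d) = play G \<sigma> (j + d)"
  by (induction d) (simp_all add: Let_def)

text \<open>The play is memoryless: a repetition at times \<open>i < j \<le> K\<close>, shifted by
  \<open>K - j\<close>, would show the vertex of time \<open>K\<close> already at time
  \<open>i + (K - j) < K\<close>.\<close>

lemma play_inj:
  assumes "\<And>k. k < K \<Longrightarrow> play G \<sigma> k \<noteq> play G \<sigma> K"
  shows "inj_on (play G \<sigma>) {..K}"
proof (rule linorder_inj_onI)
  fix i j assume ij: "i < j" "i \<in> {..K}" "j \<in> {..K}"
  show "play G \<sigma> i \<noteq> play G \<sigma> j"
  proof
    assume "play G \<sigma> i = play G \<sigma> j"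
    then have "play G \<sigma> (i + (K - j)) = play G \<sigma> K" using play_period[of \<sigma> i j "K - j"] ij by simp
    moreover have "i + (K - j) < K" using ij by auto
    ultimately show False using assms by blast
  qed
qed auto

text \<open>The first visit to a vertex is preceded by distinct vertices only, so it happens before
  time \<open>card (verts (graph G))\<close>. This bounds the number of rounds needed to trace the
  whole play.\<close>

lemma play_early:
  assumes "situation G \<sigma>"
  shows "\<exists>j < card (verts (graph G)). play G \<sigma> j = play G \<sigma> k"
proof -
  define j where "j = (LEAST j. play G \<sigma> j = play G \<sigma> k)"
  have j: "play G \<sigma> j = play G \<sigma> k" unfolding j_def by (rule LeastI) simp
  have "play G \<sigma> l \<noteq> play G \<sigma> j" if "l < j" for l
    using not_less_Least[OF that[unfolded j_def]] j by simp
  then have "inj_on (play G \<sigma>) {..j}" by (rule play_inj)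
  moreover have "play G \<sigma> ` {..j} \<subseteq> verts (graph G)" using play_vert[OF assms] by auto
  ultimately have "card {..j} \<le> card (verts (graph G))" by (rule card_inj_on_le) simp
  then show ?thesis using j by (intro exI[of _ j]) simp
qed

text \<open>Terminals are absorbing, so the vertices up to the first terminal are distinct; hence so
  are the arcs, each of which determines its tail.\<close>

lemma spent_le_sum:
  assumes "situation G \<sigma>" "play G \<sigma> K \<in> terminals G" "\<And>k. k < K \<Longrightarrow> play G \<sigma> k \<notin> terminals G"
  shows "spent G i \<sigma> K \<le> (\<Sum>e \<in> arcs (graph G). cost G i e)"
proof -
  let ?a = "\<lambda>k. chosen_arc G \<sigma> (play G \<sigma> k)"
  have out: "?a k \<in> arcs (graph G)" "tail (graph G) (?a k) = play G \<sigma> k" if "k < K" for k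
    using chosen_arc_out[OF assms(1) play_vert[OF assms(1)] assms(3)[OF that]] by auto
  have "inj_on (play G \<sigma>) {..K}" using assms(2,3) by (intro play_inj) metis
  then have "inj_on ?a {..<K}"
    using out(2) unfolding inj_on_def
    by (metis atMost_iff lessThan_iff less_imp_le)
  then have "spent G i \<sigma> K = sum (cost G i) (?a ` {..<K})"
    by (simp add: spent_def sum.reindex)
  also have "\<dots> \<le> (\<Sum>e \<in> arcs (graph G). cost G i e)"
    using out(1) by (intro sum_mono2) (auto simp: cost_pos less_imp_le)
  finally show ?thesis .
qed

lemma spent_Suc:
  "spent G i \<sigma> (Suc j) = spent G i \<sigma> j + cost G i (chosen_arc G \<sigma> (play G \<sigma> j))"
  by (simp add: spent_def)

lemma spent_nonneg_terms:
  assumes "situation G \<sigma>" "\<And>k. k < j \<Longrightarrow> play G \<sigma> k \<notin> terminals G" "i \<le> j"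
  shows "spent G p \<sigma> i \<le> spent G p \<sigma> j"
  unfolding spent_def
  using assms chosen_arc_out(1)[OF assms(1) play_vert[OF assms(1)]] cost_pos
  by (intro sum_mono2) (auto intro: less_imp_le)

lemma decreasing_terminates:
  fixes w :: "'v \<Rightarrow> real"
  assumes "situation G \<sigma>"
    and "\<And>k. play G \<sigma> k \<notin> terminals G \<Longrightarrow> w (play G \<sigma> (Suc k)) < w (play G \<sigma> k)"
  shows "terminating G \<sigma>"
proof (rule ccontr)
  assume "\<not> terminating G \<sigma>"
  then have dec: "w (play G \<sigma> (Suc k)) < w (play G \<sigma> k)" for k
    using assms(2) by (simp add: terminating_def)
  have "w (play G \<sigma> j) < w (play G \<sigma> i)" if "i < j" for i j
    using lift_Suc_mono_less[of "\<lambda>k. - w (play G \<sigma> k)" i j] dec that by simp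
  then have "inj (play G \<sigma>)" by (intro linorder_injI) (metis less_irrefl)
  moreover have "finite (range (play G \<sigma>))"
    using play_vert[OF assms(1)] by (meson finite_subset finite_verts image_subsetI)
  ultimately show False using finite_imageD by blast
qed

text \<open>A telescoping sum. It turns local inequalities for a potential into a lower bound on the
  cost, and is applied both to zero-sum values and to distances.\<close>

lemma potential_le_spent:
  assumes "\<And>k. k < j \<Longrightarrow> play G \<sigma> k \<notin> terminals G"
    and "\<And>k. k < j \<Longrightarrow> w (play G \<sigma> k) \<le> arc_value G i w (chosen_arc G \<sigma> (play G \<sigma> k))"
  shows "w (init G) \<le> spent G i \<sigma> j + w (play G \<sigma> j)"
  using assms
proof (induction j)
  case (Suc j)
  then have "w (init G) \<le> spent G i \<sigma> j + w (play G \<sigma> j)" by simp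
  also have "w (play G \<sigma> j) \<le> arc_value G i w (chosen_arc G \<sigma> (play G \<sigma> j))" using Suc.prems by simp
  finally show ?case using Suc.prems(1)[of j] by (simp add: spent_Suc arc_value_def Let_def)
qed (simp add: spent_def)


subsection \<open>Equilibria from greedy arcs\<close>

lemma admissible_arcs: "admissible G (arcs (graph G))"
  unfolding admissible_def terminals_def out_arcs_def by blast

text \<open>The arcs that remain when player \<open>i\<close> is committed to \<open>a\<close>; the
  other player keeps all arcs. Iteration for that player on this set solves a shortest path
  problem.\<close>

definition restricted :: "player \<Rightarrow> ('v \<Rightarrow> 'e) \<Rightarrow> 'e set" where
  "restricted i a = {e \<in> arcs (graph G). tail (graph G) e \<in> ctrl G i \<longrightarrow> e = a (tail (graph G) e)}"

lemma admissible_restricted: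
  assumes "greedy G j (arcs (graph G)) w a"
  shows "admissible G (restricted i a)"
  unfolding admissible_def
proof (intro conjI ballI)
  fix x assume "x \<in> verts (graph G) - terminals G"
  then have "a x \<in> arcs (graph G)" "tail (graph G) (a x) = x"
    using assms by (auto simp: greedy_def)
  then show "\<exists>e \<in> restricted i a. tail (graph G) e = x"
    by (intro bexI[of _ "a x"]) (auto simp: restricted_def)
qed (auto simp: restricted_def)

lemma situation_update:
  "situation G \<sigma> \<Longrightarrow> strategy G i \<tau> \<Longrightarrow> situation G (\<sigma>(i := \<tau>))"
  by (simp add: situation_def)

lemma situation_outI:
  assumes "\<And>i x. x \<in> ctrl G i \<Longrightarrow> \<sigma> i x \<in> arcs (graph G) \<and> tail (graph G) (\<sigma> i x) = x"
  shows "situation G \<sigma>"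
  using assms by (auto simp: situation_def strategy_def out_arcs_def)

text \<open>This case is split off because the strict bound \<open>sum_less_cap\<close> requires a
  nonterminal vertex: without arcs the cap is 0, and value at the cap says nothing about
  blocking.\<close>

lemma nash_if_init_terminal:
  assumes "situation G \<sigma>" "init G \<in> terminals G"
  shows "nash_equilibrium G \<sigma>"
proof -
  have zero: "effective_cost G i \<sigma>' = 0" for i \<sigma>'
  proof -
    have "play G \<sigma>' 0 \<in> terminals G" using assms(2) by simp
    then have "(LEAST k. play G \<sigma>' k \<in> terminals G) = 0" "terminating G \<sigma>'"
      unfolding terminating_def by (blast intro: Least_eq_0)+
    then show ?thesis by (simp add: effective_cost_def zero_ereal_def)
  qed
  show ?thesis using assms(1) by (simp add: nash_equilibrium_def zero)
qed

text \<open>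
  Against the greedy arcs of the opponent, a terminating play would cost player \<open>i\<close> at least
  \<open>cap G i\<close>, which is more than the cost of any path.
\<close>
lemma blocked_not_terminating:
  assumes sit: "situation G \<sigma>"
    and greedy: "greedy G i (arcs (graph G)) (game_value G i (arcs (graph G))) a"
    and val: "game_value G i (arcs (graph G)) (init G) = cap G i"
    and init: "init G \<notin> terminals G"
    and blocks: "\<And>x. x \<in> ctrl G (opponent i) \<Longrightarrow> \<sigma> (opponent i) x = a x"
  shows "\<not> terminating G \<sigma>"
proof
  let ?v = "game_value G i (arcs (graph G))"
  assume "terminating G \<sigma>"
  then obtain K where K: "play G \<sigma> K \<in> terminals G" "\<And>k. k < K \<Longrightarrow> play G \<sigma> k \<notin> terminals G"
    by (rule terminating_cases) blast
  have "?v (play G \<sigma> k) \<le> arc_value G i ?v (chosen_arc G \<sigma> (play G \<sigma> k))" if "k < K" for k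
  proof -
    let ?x = "play G \<sigma> k"
    note x = play_vert[OF sit, of k] K(2)[OF that]
    from x show ?thesis
    proof (cases rule: ctrl_cases[where i = i])
      case 1
      then show ?thesis
        using game_value_le_arc[OF order_refl] chosen_arc_out[OF sit x] by metis
    next
      case 2
      then have "chosen_arc G \<sigma> ?x = a ?x" using chosen_arc_ctrl blocks by metis
      then show ?thesis using 2 greedy x by (auto simp: greedy_def)
    qed
  qed
  from potential_le_spent[of K \<sigma> ?v i, OF K(2) this]
  have "cap G i \<le> spent G i \<sigma> K"
    using val game_value_terminal[OF order_refl K(1), of i] by simp
  then show False using spent_le_sum[OF sit K(1) K(2), of i] sum_less_cap[OF init_vert init, of i] by simp
qed

lemma opponent_opponent [simp]: "opponent (opponent i) = i"
  by (cases i) (auto simp: opponent_def)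

lemma opponent_neq [simp]: "opponent i \<noteq> i" "i \<noteq> opponent i"
  by (cases i; simp add: opponent_def)+

text \<open>The roles are crossed: of \<open>a i\<close> only the maximizing arcs at the vertices of
  the opponent of \<open>i\<close> are used, so each player takes the arcs from the other's game. A
  deviation of \<open>i\<close> leaves them in place and therefore costs \<open>\<infinity>\<close>,
  which is all that has to be checked.\<close>

lemma nash_if_both_blocked:
  assumes greedy: "\<And>i. greedy G i (arcs (graph G)) (game_value G i (arcs (graph G))) (a i)"
    and val: "\<And>i. game_value G i (arcs (graph G)) (init G) = cap G i"
    and \<sigma>: "\<And>i x. x \<in> ctrl G i \<Longrightarrow> \<sigma> i x = a (opponent i) x"
  shows "nash_equilibrium G \<sigma>"
proof -
  have sit: "situation G \<sigma>"
    using greedy \<sigma> ctrl_vert by (intro situation_outI) (auto simp: greedy_def)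
  show ?thesis
  proof (cases "init G \<in> terminals G")
    case True
    then show ?thesis using nash_if_init_terminal[OF sit] by simp
  next
    case False
    have "effective_cost G i (\<sigma>(i := \<tau>)) = \<infinity>" if "strategy G i \<tau>" for i \<tau>
    proof -
      have "\<not> terminating G (\<sigma>(i := \<tau>))"
        by (rule blocked_not_terminating[OF situation_update[OF sit that] greedy[of i] val False])
          (simp add: \<sigma>)
      then show ?thesis by (simp add: effective_cost_def)
    qed
    then show ?thesis using sit by (simp add: nash_equilibrium_def)
  qed
qed

text \<open>\<open>a\<close> holds the optimal arcs of \<open>q\<close> together with the opponent's
  maximizing arcs; \<open>d\<close> is the opponent's distance to the terminals once
  \<open>q\<close> is committed to \<open>a\<close>, and \<open>b\<close> follows it. At vertices of
  \<open>q\<close> only the arc \<open>a x\<close> is left, so \<open>b\<close> agrees with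
  \<open>a\<close> there, and the situation \<open>\<lambda>_. b\<close>, one function shared by
  both players, has \<open>P\<close> as its play.\<close>

context
  fixes q p :: player and a b :: "'v \<Rightarrow> 'e" and \<sigma> :: "player \<Rightarrow> 'v \<Rightarrow> 'e" and v d :: "'v \<Rightarrow> real"
  defines "p \<equiv> opponent q"
    and "v \<equiv> game_value G q (arcs (graph G))"
    and "d \<equiv> game_value G p (restricted q a)"
  assumes a: "greedy G q (arcs (graph G)) v a"
    and init_val: "v (init G) < cap G q"
    and b: "greedy G p (restricted q a) d b"
    and \<sigma>_q: "\<And>x. x \<in> ctrl G q \<Longrightarrow> \<sigma> q x = a x"
    and \<sigma>_p: "\<And>x. x \<in> ctrl G p \<Longrightarrow> \<sigma> p x = (if \<exists>k. x = play G (\<lambda>_. b) k then b x else a x)"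
begin

lemma restricted_arcs: "restricted q a \<subseteq> arcs (graph G)"
  by (auto simp: restricted_def)

lemma a_out: "x \<in> verts (graph G) - terminals G \<Longrightarrow> a x \<in> arcs (graph G) \<and> tail (graph G) (a x) = x"
  using a by (simp add: greedy_def)

lemma b_out:
  "x \<in> verts (graph G) - terminals G \<Longrightarrow> b x \<in> restricted q a \<and> b x \<in> arcs (graph G) \<and> tail (graph G) (b x) = x"
  using b restricted_arcs by (auto simp: greedy_def)

lemma b_eq_a: "x \<in> ctrl G q \<Longrightarrow> b x = a x"
  using b_out[of x] ctrl_vert[of x q] by (auto simp: restricted_def)

lemma situation_b: "situation G (\<lambda>_. b)"
  using b_out ctrl_vert by (intro situation_outI) blast

lemma situation_\<sigma>: "situation G \<sigma>"
proof (rule situation_outI)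
  fix i x assume x: "x \<in> ctrl G i"
  have "i = q \<or> i = p" by (cases i; cases q) (auto simp: p_def opponent_def)
  then show "\<sigma> i x \<in> arcs (graph G) \<and> tail (graph G) (\<sigma> i x) = x"
    using x a_out[of x] b_out[of x] ctrl_vert[OF x] \<sigma>_q[of x] \<sigma>_p[of x] by auto
qed

lemma chosen_b: "chosen_arc G (\<lambda>_. b) x = b x"
  by (simp add: chosen_arc_def)

lemma chosen_on_path:
  assumes "x = play G (\<lambda>_. b) k" "x \<notin> terminals G"
  shows "chosen_arc G \<sigma> x = b x"
proof -
  have "x \<in> verts (graph G)" using assms(1) play_vert[OF situation_b] by simp
  from this assms(2) show ?thesis
  proof (cases rule: ctrl_cases[where i = q])
    case 1
    then show ?thesis using chosen_arc_ctrl[of x q \<sigma>] \<sigma>_q b_eq_a by simp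
  next
    case 2
    then show ?thesis using chosen_arc_ctrl[of x p \<sigma>] \<sigma>_p assms(1) by (auto simp: p_def)
  qed
qed

lemma play_\<sigma>: "play G \<sigma> k = play G (\<lambda>_. b) k"
proof (induction k)
  case (Suc k)
  then show ?case using chosen_on_path[OF refl, of k] by (simp add: Let_def chosen_b)
qed simp

lemma value_drop:
  assumes "x \<in> verts (graph G)" "x \<notin> terminals G" "e \<in> arcs (graph G)" "tail (graph G) e = x"
    "x \<in> ctrl G q \<Longrightarrow> e = a x" "v x < cap G q"
  shows "arc_value G q v e \<le> v x"
proof (cases "x \<in> ctrl G q")
  case True
  then show ?thesis using a assms by (simp add: greedy_def)
next
  case False
  then show ?thesis using game_value_ge_arc[OF order_refl assms(3,4) False] assms(6) by (simp add: v_def)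
qed

text \<open>Below the cap, the greedy arc of \<open>q\<close> attains the minimum and a maximum
  dominates all arcs of the opponent. So each step costs \<open>q\<close> at most the drop of
  \<open>v\<close>, and the play stays below the cap whatever the opponent does.\<close>

lemma value_along_play:
  assumes sit: "situation G \<rho>" and \<rho>: "\<And>x. x \<in> ctrl G q \<Longrightarrow> \<rho> q x = a x"
  shows "v (play G \<rho> k) < cap G q"
    and "play G \<rho> k \<notin> terminals G \<Longrightarrow>
      arc_value G q v (chosen_arc G \<rho> (play G \<rho> k)) \<le> v (play G \<rho> k)"
    and "play G \<rho> k \<notin> terminals G \<Longrightarrow> v (play G \<rho> (Suc k)) < v (play G \<rho> k)"
proof -
  have step: "arc_value G q v (chosen_arc G \<rho> (play G \<rho> k)) \<le> v (play G \<rho> k) \<and>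
      v (play G \<rho> (Suc k)) < v (play G \<rho> k)"
    if "play G \<rho> k \<notin> terminals G" "v (play G \<rho> k) < cap G q" for k
  proof -
    let ?x = "play G \<rho> k"
    note out = chosen_arc_out[OF sit play_vert[OF sit] that(1)]
    have "arc_value G q v (chosen_arc G \<rho> ?x) \<le> v ?x"
      using chosen_arc_ctrl[of ?x q \<rho>] \<rho>
      by (intro value_drop play_vert[OF sit] that out) simp
    then show ?thesis
      using cost_pos[OF out(1), of q] by (simp add: play_step[OF that(1)] arc_value_def del: play.simps)
  qed
  show less: "v (play G \<rho> k) < cap G q" for k
  proof (induction k)
    case 0
    then show ?case by (simp add: init_val)
  next
    case (Suc k)
    show ?case
    proof (cases "play G \<rho> k \<in> terminals G")
      case True
      then show ?thesis using Suc by simp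
    next
      case False
      then show ?thesis using step[OF False Suc] Suc by linarith
    qed
  qed
  show "play G \<rho> k \<notin> terminals G \<Longrightarrow>
      arc_value G q v (chosen_arc G \<rho> (play G \<rho> k)) \<le> v (play G \<rho> k)"
    "play G \<rho> k \<notin> terminals G \<Longrightarrow> v (play G \<rho> (Suc k)) < v (play G \<rho> k)"
    using step less by blast+
qed

lemma terminating_against_a:
  assumes "situation G \<rho>" "\<And>x. x \<in> ctrl G q \<Longrightarrow> \<rho> q x = a x"
  shows "terminating G \<rho>"
  by (rule decreasing_terminates[of \<rho> v]) (use assms value_along_play(3)[of \<rho>] in auto)

text \<open>The restriction binds \<open>q\<close> only, so a minimum at a vertex of
  \<open>p\<close> ranges over every arc a deviating \<open>p\<close> could use. Hence
  \<open>d\<close> is a potential for all plays against \<open>a\<close>.\<close>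

lemma distance_le_arc:
  assumes sit: "situation G \<rho>" and \<rho>: "\<And>x. x \<in> ctrl G q \<Longrightarrow> \<rho> q x = a x"
    and x: "x \<in> verts (graph G)" "x \<notin> terminals G"
  shows "d x \<le> arc_value G p d (chosen_arc G \<rho> x)"
  using x
proof (cases rule: ctrl_cases[where i = q])
  case 1
  then have "chosen_arc G \<rho> x = b x"
    using chosen_arc_ctrl[of x q \<rho>] \<rho> b_eq_a by simp
  then show ?thesis using b 1 x by (auto simp: greedy_def p_def)
next
  case 2
  have "chosen_arc G \<rho> x \<in> restricted q a"
    using chosen_arc_out[OF sit x] 2 by (simp add: restricted_def)
  then show ?thesis
    using game_value_le_arc[OF restricted_arcs, of x p] 2 chosen_arc_out[OF sit x]
    by (simp add: d_def p_def)
qed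

lemma distance_le_cost:
  assumes sit: "situation G \<rho>" and \<rho>: "\<And>x. x \<in> ctrl G q \<Longrightarrow> \<rho> q x = a x"
    and K: "play G \<rho> K \<in> terminals G" "\<And>k. k < K \<Longrightarrow> play G \<rho> k \<notin> terminals G"
  shows "d (init G) \<le> spent G p \<rho> K"
proof -
  have "d (play G \<rho> K) = 0"
    using game_value_terminal[OF restricted_arcs K(1)] by (simp add: d_def)
  then show ?thesis
    using potential_le_spent[of K \<rho> d p, OF K(2) distance_le_arc[OF sit \<rho> play_vert[OF sit] K(2)]]
    by simp
qed

text \<open>The play of \<open>b\<close> meets the arcs \<open>a\<close> and so terminates; its cost
  bounds \<open>d (init G)\<close> from above by less than the cap. Greedy arcs of \<open>p\<close>
  are informative only below the cap.\<close>

lemma init_distance_less: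
  assumes "init G \<notin> terminals G"
  shows "d (init G) < cap G p"
proof -
  obtain K where K: "play G (\<lambda>_. b) K \<in> terminals G" "\<And>k. k < K \<Longrightarrow> play G (\<lambda>_. b) k \<notin> terminals G"
    using terminating_against_a[OF situation_b] b_eq_a by (metis terminating_cases)
  show ?thesis
    using distance_le_cost[OF situation_b _ K] spent_le_sum[OF situation_b K, of p]
      sum_less_cap[OF init_vert assms, of p] b_eq_a
    by force
qed

text \<open>The induction sustains itself: cost so far plus remaining distance is at most
  \<open>d (init G)\<close>, so the distance at the current vertex is again below the cap and the
  next arc of \<open>b\<close> is tight.\<close>

lemma path_cost:
  assumes init: "init G \<notin> terminals G"
    and "\<And>k. k < j \<Longrightarrow> play G (\<lambda>_. b) k \<notin> terminals G"
  shows "spent G p (\<lambda>_. b) j + d (play G (\<lambda>_. b) j) \<le> d (init G)"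
  using assms(2)
proof (induction j)
  case 0
  then show ?case by (simp add: spent_def)
next
  case (Suc j)
  let ?x = "play G (\<lambda>_. b) j"
  have IH: "spent G p (\<lambda>_. b) j + d ?x \<le> d (init G)" using Suc by simp
  have nt: "?x \<notin> terminals G" using Suc.prems by simp
  have x: "?x \<in> verts (graph G) - terminals G" using play_vert[OF situation_b] nt by simp
  have "0 \<le> spent G p (\<lambda>_. b) j"
    using spent_nonneg_terms[OF situation_b, of j 0 p] Suc.prems by (simp add: spent_def)
  then have less: "d ?x < cap G p" using IH init_distance_less[OF init] by linarith
  have "arc_value G p d (b ?x) \<le> d ?x"
  proof (cases "?x \<in> ctrl G p")
    case True
    then show ?thesis using b x less by (simp add: greedy_def)
  next
    case False
    then show ?thesis
      using game_value_ge_arc[OF restricted_arcs _ _ False] b_out[OF x] less by (simp add: d_def)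
  qed
  then show ?case using IH nt by (simp add: spent_Suc arc_value_def Let_def chosen_b)
qed

lemma spent_\<sigma>:
  assumes "\<And>k. k < j \<Longrightarrow> play G (\<lambda>_. b) k \<notin> terminals G"
  shows "spent G i \<sigma> j = spent G i (\<lambda>_. b) j"
  unfolding spent_def play_\<sigma> using assms chosen_on_path[OF refl] by (intro sum.cong) (auto simp: chosen_b)

lemma spent_value_antimono:
  assumes "i \<le> j" "\<And>k. k < j \<Longrightarrow> play G (\<lambda>_. b) k \<notin> terminals G"
  shows "spent G q (\<lambda>_. b) j + v (play G (\<lambda>_. b) j) \<le> spent G q (\<lambda>_. b) i + v (play G (\<lambda>_. b) i)"
  using assms
proof (induction j rule: dec_induct)
  case (step j)
  then show ?case
    using value_along_play(2)[OF situation_b b_eq_a, of j] play_step[of "\<lambda>_. b" j]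
    by (simp add: spent_Suc arc_value_def)
qed simp

text \<open>
  A deviation that leaves \<open>P\<close> at its \<open>i\<close>-th vertex is charged at least the drop of \<open>v\<close> since
  then, and along \<open>P\<close> itself the cost is at most the drop of \<open>v\<close>.
\<close>
lemma deviation_invariant:
  fixes \<tau> :: "'v \<Rightarrow> 'e"
  defines "\<rho> \<equiv> \<sigma>(q := \<tau>)" and "\<pi> \<equiv> play G (\<lambda>_. b)" and "g \<equiv> spent G q (\<lambda>_. b)"
  assumes \<tau>: "strategy G q \<tau>"
    and K: "\<pi> K \<in> terminals G" "\<And>k. k < K \<Longrightarrow> \<pi> k \<notin> terminals G"
    and nt: "\<And>k. k < j \<Longrightarrow> play G \<rho> k \<notin> terminals G"
  shows "\<exists>i \<le> K. g i \<le> spent G q \<rho> j \<and> g i + v (\<pi> i) \<le> spent G q \<rho> j + v (play G \<rho> j)"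
  using nt
proof (induction j)
  case 0
  then show ?case by (intro exI[of _ 0]) (simp add: g_def \<pi>_def spent_def)
next
  case (Suc j)
  let ?x = "play G \<rho> j" and ?C = "spent G q \<rho> j"
  let ?e = "chosen_arc G \<rho> ?x"
  have sit: "situation G \<rho>" unfolding \<rho>_def by (rule situation_update[OF situation_\<sigma> \<tau>])
  have nt: "?x \<notin> terminals G" using Suc.prems by simp
  note x = play_vert[OF sit, of j] nt
  note out = chosen_arc_out[OF sit x]
  have C': "spent G q \<rho> (Suc j) = ?C + cost G q ?e" by (simp add: spent_Suc)
  have x': "play G \<rho> (Suc j) = head (graph G) ?e" by (rule play_step[OF nt])
  have pos: "0 < cost G q ?e" using cost_pos[OF out(1)] .
  obtain i where i: "i \<le> K" "g i \<le> ?C" "g i + v (\<pi> i) \<le> ?C + v ?x"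
    using Suc by auto
  have g_mono: "g l \<le> g l'" if "l \<le> l'" "l' \<le> K" for l l'
    unfolding g_def using that K(2) by (intro spent_nonneg_terms[OF situation_b]) (auto simp: \<pi>_def)
  have g_step: "g (Suc l) = g l + cost G q (b (\<pi> l))" for l
    by (simp add: g_def \<pi>_def spent_Suc chosen_b)
  have gv_mono: "g l' + v (\<pi> l') \<le> g l + v (\<pi> l)" if "l \<le> l'" "l' \<le> K" for l l'
    using spent_value_antimono[OF that(1)] that(2) K(2) by (simp add: g_def \<pi>_def)
  show ?case
  proof (cases "v ?x \<le> arc_value G q v ?e")
    case up: True
    then show ?thesis
      using i pos by (intro exI[of _ i]) (simp add: C' x' arc_value_def del: play.simps)
  next
    \<comment> \<open>The value can fall by more than the cost neither at a vertex of
      \<open>q\<close>, where it is a minimum over arcs, nor at a vertex of \<open>p\<close> outside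
      \<open>P\<close>, where \<open>\<sigma>\<close> plays the maximizing arc. So this step uses an
      arc of \<open>P\<close>, and the witness jumps to the end of that arc.\<close>
    case down: False
    have "?x \<notin> ctrl G q"
      using down out game_value_le_arc[OF order_refl, of ?x q ?e] by (auto simp: v_def)
    then have xp: "?x \<in> ctrl G p" "?x \<notin> ctrl G q"
      using ctrl_cases[OF x, of q] by (auto simp: p_def)
    have e: "?e = \<sigma> p ?x" using chosen_arc_ctrl[OF xp(1), of \<rho>] by (simp add: \<rho>_def p_def)
    have "\<exists>k. ?x = \<pi> k"
    proof (rule ccontr)
      assume "\<not> ?thesis"
      then have "?e = a ?x" using e \<sigma>_p[OF xp(1)] by (simp add: \<pi>_def)
      then show False using a xp(2) x down by (auto simp: greedy_def)
    qed
    then obtain l0 where l0: "?x = \<pi> l0" by blast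
    have "l0 < K"
      using l0 nt play_terminal_stays[of "\<lambda>_. b" K l0] K(1) by (metis \<pi>_def leI)
    have eb: "?e = b ?x" using e \<sigma>_p[OF xp(1)] l0 by (auto simp: \<pi>_def)
    \<comment> \<open>The deviation may rejoin \<open>P\<close> before or after the
      \<open>i\<close>-th vertex, hence the two halves of the invariant. Not beyond
      \<open>i\<close>, the costs along \<open>P\<close> are monotone. Beyond \<open>i\<close>, the
      sum of cost and value does not grow along \<open>P\<close>, and the value at
      \<open>?x = \<pi> l0\<close> cancels.\<close>
    have "g l0 \<le> ?C"
    proof (cases "l0 \<le> i")
      case True
      then show ?thesis using g_mono[of l0 i] i by linarith
    next
      case False
      then show ?thesis using gv_mono[of i l0] i l0 \<open>l0 < K\<close> by simp
    qed
    moreover have "play G \<rho> (Suc j) = \<pi> (Suc l0)"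
      using x' eb l0 nt play_step[of "\<lambda>_. b" l0] by (simp add: \<pi>_def chosen_b)
    ultimately show ?thesis
      using \<open>l0 < K\<close> g_step[of l0] eb l0 C' by (intro exI[of _ "Suc l0"]) simp
  qed
qed

text \<open>For \<open>q\<close>, the invariant is read at the end of a terminating deviation, where
  \<open>v\<close> vanishes, and compared with the rest of \<open>P\<close>. For \<open>p\<close>,
  \<open>d (init G)\<close> bounds from below the cost of every terminating play against
  \<open>a\<close>, and from above the cost of \<open>P\<close>.\<close>

lemma nash_shortest_path: "nash_equilibrium G \<sigma>"
proof (cases "init G \<in> terminals G")
  case True
  then show ?thesis using nash_if_init_terminal[OF situation_\<sigma>] by simp
next
  case init: False
  let ?\<pi> = "play G (\<lambda>_. b)"
  have "terminating G \<sigma>" by (rule terminating_against_a[OF situation_\<sigma> \<sigma>_q])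
  then obtain K where K: "play G \<sigma> K \<in> terminals G" "\<And>k. k < K \<Longrightarrow> play G \<sigma> k \<notin> terminals G"
    "\<And>i. effective_cost G i \<sigma> = ereal (spent G i \<sigma> K)" by (rule terminating_cases) blast
  note K\<pi> = K(1,2)[unfolded play_\<sigma>]
  have cost_K: "effective_cost G i \<sigma> = ereal (spent G i (\<lambda>_. b) K)" for i
    using K(3) spent_\<sigma>[OF K\<pi>(2)] by simp
  have "effective_cost G i \<sigma> \<le> effective_cost G i (\<sigma>(i := \<tau>))" if \<tau>: "strategy G i \<tau>" for i \<tau>
  proof (cases "terminating G (\<sigma>(i := \<tau>))")
    case False
    then show ?thesis by (simp add: effective_cost_def)
  next
    case True
    let ?\<rho> = "\<sigma>(i := \<tau>)"
    obtain J where J: "play G ?\<rho> J \<in> terminals G" "\<And>k. k < J \<Longrightarrow> play G ?\<rho> k \<notin> terminals G"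
      "effective_cost G i ?\<rho> = ereal (spent G i ?\<rho> J)"
      using True by (rule terminating_cases) blast
    have sit: "situation G ?\<rho>" by (rule situation_update[OF situation_\<sigma> \<tau>])
    have "spent G i (\<lambda>_. b) K \<le> spent G i ?\<rho> J"
    proof (cases "i = q")
      case True
      obtain l where l: "l \<le> K" "spent G q (\<lambda>_. b) l + v (?\<pi> l) \<le> spent G q ?\<rho> J + v (play G ?\<rho> J)"
        using deviation_invariant[of \<tau> K J] \<tau> True J(2) K\<pi> by auto
      have "v (play G ?\<rho> J) = 0" using game_value_terminal[OF order_refl J(1)] by (simp add: v_def)
      moreover have "spent G q (\<lambda>_. b) K \<le> spent G q (\<lambda>_. b) l + v (?\<pi> l)"
        using spent_value_antimono[OF l(1)] K\<pi>(2) game_value_nonneg[OF order_refl, of q "?\<pi> K"]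
        by (simp add: v_def)
      ultimately show ?thesis using l True by simp
    next
      case False
      then have i: "i = p" by (cases i; cases q) (auto simp: p_def opponent_def)
      have "d (init G) \<le> spent G p ?\<rho> J"
        by (rule distance_le_cost[OF sit _ J(1,2)]) (use False \<sigma>_q in auto)
      moreover have "spent G p (\<lambda>_. b) K \<le> d (init G)"
        using path_cost[OF init, of K] K\<pi>(2) game_value_nonneg[OF restricted_arcs, of p "?\<pi> K"]
        by (simp add: d_def)
      ultimately show ?thesis using i by simp
    qed
    then show ?thesis using cost_K J(3) by simp
  qed
  then show ?thesis using situation_\<sigma> by (simp add: nash_equilibrium_def)
qed

end

theorem ex_nash_equilibrium: "\<exists>\<sigma>. nash_equilibrium G \<sigma>"
proof -
  let ?v = "\<lambda>i. game_value G i (arcs (graph G))"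
  obtain a where a: "\<And>i. greedy G i (arcs (graph G)) (?v i) (a i)"
    using ex_greedy[OF order_refl admissible_arcs] by metis
  show ?thesis
  proof (cases "\<exists>q. ?v q (init G) < cap G q")
    case True
    then obtain q where q: "?v q (init G) < cap G q" by blast
    let ?E = "restricted q (a q)"
    obtain b where b: "greedy G (opponent q) ?E (game_value G (opponent q) ?E) b"
      using ex_greedy[OF _ admissible_restricted[OF a]] unfolding restricted_def by blast
    show ?thesis
      by (rule exI, rule nash_shortest_path[OF a q b,
            where \<sigma> = "\<lambda>i x. if i = q then a q x else if \<exists>k. x = play G (\<lambda>_. b) k then b x else a q x"])
        auto
  next
    case False
    then have "?v i (init G) = cap G i" for i
      using game_value_le_cap[OF order_refl, of i "init G"] by (meson linorder_not_less order_antisym)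
    then have "nash_equilibrium G (\<lambda>i. a (opponent i))"
      by (intro nash_if_both_blocked[OF a]) auto
    then show ?thesis by blast
  qed
qed

end


section \<open>Bounded execution of programs\<close>

text \<open>The postcondition may itself be a \<open>runs\<close> statement about the next program;
  this is how \<open>runs_Seq\<close> chains time bounds.\<close>

definition runs :: "com \<Rightarrow> store \<Rightarrow> nat \<Rightarrow> (store \<Rightarrow> bool) \<Rightarrow> bool" where
  "runs c s T Q \<longleftrightarrow> (\<exists>t s'. exec c s t s' \<and> t \<le> T \<and> Q s')"

lemma runs_mono:
  "runs c s T Q \<Longrightarrow> (\<And>s'. Q s' \<Longrightarrow> Q' s') \<Longrightarrow> T \<le> T' \<Longrightarrow> runs c s T' Q'"
  unfolding runs_def using le_trans by blast

lemma runs_Seq: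
  assumes "runs c s T (\<lambda>s'. runs c' s' T' Q)" "T + T' \<le> U"
  shows "runs (Seq c c') s U Q"
proof -
  obtain t s1 t' s2 where "exec c s t s1" "t \<le> T" "exec c' s1 t' s2" "t' \<le> T'" "Q s2"
    using assms(1) unfolding runs_def by blast
  moreover from this have "t + t' \<le> U" using assms(2) by linarith
  ultimately show ?thesis unfolding runs_def by (blast intro: exec.Seq)
qed

lemma runs_Cond:
  assumes "bval b s \<Longrightarrow> runs c s T Q" "\<not> bval b s \<Longrightarrow> runs c' s T Q" "Suc T \<le> U"
  shows "runs (Cond b c c') s U Q"
proof (cases "bval b s")
  case True
  then obtain t s' where "exec c s t s'" "t \<le> T" "Q s'" using assms(1) unfolding runs_def by blast
  then show ?thesis unfolding runs_def using assms(3)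
    by (intro exI[of _ "Suc t"] exI[of _ s'] conjI exec.CondTrue[OF True]) simp_all
next
  case False
  then obtain t s' where "exec c' s t s'" "t \<le> T" "Q s'" using assms(2) unfolding runs_def by blast
  then show ?thesis unfolding runs_def using assms(3)
    by (intro exI[of _ "Suc t"] exI[of _ s'] conjI exec.CondFalse[OF False]) simp_all
qed

section \<open>Symbolic execution of loop-free programs\<close>

primrec loop_free :: "com \<Rightarrow> bool" where
  "loop_free Skip \<longleftrightarrow> True"
| "loop_free (NAssign a x y) \<longleftrightarrow> True"
| "loop_free (RAssign a x y) \<longleftrightarrow> True"
| "loop_free (Seq c c') \<longleftrightarrow> loop_free c \<and> loop_free c'"
| "loop_free (Cond b c c') \<longleftrightarrow> loop_free c \<and> loop_free c'"
| "loop_free (While b c) \<longleftrightarrow> False"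

text \<open>Loop bodies become functions on stores that the simplifier can evaluate, leaving
  invariants to the loops alone. The clause for \<open>While\<close> is a dummy excluded by
  \<open>loop_free\<close>.\<close>

primrec effect :: "com \<Rightarrow> store \<Rightarrow> store" where
  "effect Skip s = s"
| "effect (NAssign a x y) s = nwrite a (nval x s) (nval y s) s"
| "effect (RAssign a x y) s = rwrite a (nval x s) (rval y s) s"
| "effect (Seq c c') s = effect c' (effect c s)"
| "effect (Cond b c c') s = (if bval b s then effect c s else effect c' s)"
| "effect (While b c) s = s"

primrec duration :: "com \<Rightarrow> nat" where
  "duration Skip = 1"
| "duration (NAssign a x y) = 1"
| "duration (RAssign a x y) = 1"
| "duration (Seq c c') = duration c + duration c'"
| "duration (Cond b c c') = Suc (max (duration c) (duration c'))"
| "duration (While b c) = 0"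

lemma runs_loop_free:
  assumes "loop_free c" "Q (effect c s)" "duration c \<le> T"
  shows "runs c s T Q"
proof -
  have "runs c s (duration c) (\<lambda>s'. s' = effect c s)"
    using assms(1)
  proof (induction c arbitrary: s)
    case (Seq c c')
    have "runs c' (effect c s) (duration c') (\<lambda>s'. s' = effect (Seq c c') s)"
      using Seq.IH(2)[of "effect c s"] Seq.prems by simp
    then have "runs c s (duration c) (\<lambda>s1. runs c' s1 (duration c') (\<lambda>s'. s' = effect (Seq c c') s))"
      using Seq.IH(1)[of s] Seq.prems by (auto elim: runs_mono)
    then show ?case by (rule runs_Seq) simp
  next
    case (Cond b c c')
    have "runs c s (max (duration c) (duration c')) (\<lambda>s'. s' = effect c s)"
      "runs c' s (max (duration c) (duration c')) (\<lambda>s'. s' = effect c' s)"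
      using Cond.prems by (auto intro: runs_mono[OF Cond.IH(1)] runs_mono[OF Cond.IH(2)])
    then show ?case by (intro runs_Cond[where T = "max (duration c) (duration c')"]) simp_all
  qed (auto simp: runs_def intro: exec.intros)
  then show ?thesis by (rule runs_mono) (use assms(2,3) in auto)
qed

section \<open>Counting loops and frame conditions\<close>

definition for_loop :: "nat \<Rightarrow> nexp \<Rightarrow> com \<Rightarrow> com" where
  "for_loop c b body =
     Seq (NAssign c (NConst 0) (NConst 0))
       (While (NLess (NRead c (NConst 0)) b)
         (Seq body (NAssign c (NConst 0) (NAdd (NRead c (NConst 0)) (NConst 1)))))"

lemma nmem_nwrite [simp]: "nmem (nwrite a j x s) = (nmem s)(a := (nmem s a)(j := x))"
  by (simp add: nwrite_def)

lemma rmem_nwrite [simp]: "rmem (nwrite a j x s) = rmem s"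
  by (simp add: nwrite_def)

lemma nmem_rwrite [simp]: "nmem (rwrite a j x s) = nmem s"
  by (simp add: rwrite_def)

lemma rmem_rwrite [simp]: "rmem (rwrite a j x s) = (rmem s)(a := (rmem s a)(j := x))"
  by (simp add: rwrite_def)

text \<open>Each round pays for the test and the increment besides the body, whence
  \<open>T + 2\<close>; the final \<open>2\<close> is the initialization and the failing last test.
  The bound expression is evaluated anew in every round, so the invariant has to keep its value
  fixed.\<close>

lemma runs_for_loop:
  assumes start: "I 0 (nwrite c 0 0 s)"
    and bound: "\<And>k s. I k s \<Longrightarrow> nval b s = N"
    and body: "\<And>k s. k < N \<Longrightarrow> I k s \<Longrightarrow> nmem s c 0 = k \<Longrightarrow>
      runs body s T (\<lambda>s'. nmem s' c 0 = k \<and> I (Suc k) (nwrite c 0 (Suc k) s'))"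
    and final: "\<And>s. I N s \<Longrightarrow> Q s"
    and time: "N * (T + 2) + 2 \<le> U"
  shows "runs (for_loop c b body) s U Q"
proof -
  let ?inc = "NAssign c (NConst 0) (NAdd (NRead c (NConst 0)) (NConst 1))"
  let ?loop = "While (NLess (NRead c (NConst 0)) b) (Seq body ?inc)"
  have "runs ?loop s (l * (T + 2) + 1) (I N)" if "I k s" "nmem s c 0 = k" "k + l = N" for k l s
    using that
  proof (induction l arbitrary: k s)
    case 0
    then have "\<not> bval (NLess (NRead c (NConst 0)) b) s" using bound[of k s] by simp
    then show ?case
      using 0 exec.WhileFalse unfolding runs_def by (intro exI[of _ 1] exI[of _ s]) simp
  next
    case (Suc l)
    then have b: "bval (NLess (NRead c (NConst 0)) b) s" using bound[of k s] by simp
    obtain t s1 where 1: "exec body s t s1" "t \<le> T" "nmem s1 c 0 = k" "I (Suc k) (nwrite c 0 (Suc k) s1)"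
      using body[of k s] Suc.prems unfolding runs_def by auto
    have "exec ?inc s1 1 (nwrite c 0 (Suc k) s1)"
      using exec.NAssign[of c "NConst 0" "NAdd (NRead c (NConst 0)) (NConst 1)" s1] 1(3) by simp
    from exec.Seq[OF 1(1) this] have 2: "exec (Seq body ?inc) s (t + 1) (nwrite c 0 (Suc k) s1)" .
    obtain t' s2 where 3: "exec ?loop (nwrite c 0 (Suc k) s1) t' s2" "t' \<le> l * (T + 2) + 1" "I N s2"
      using Suc.IH[OF 1(4)] Suc.prems unfolding runs_def by auto
    show ?case
      unfolding runs_def using 1(2) 3(2,3)
      by (intro exI[of _ "Suc (t + 1 + t')"] exI[of _ s2] conjI exec.WhileTrue[OF b 2 3(1)]) simp_all
  qed
  from this[OF start, of N] have "runs ?loop (nwrite c 0 0 s) (N * (T + 2) + 1) (I N)" by simp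
  then have loop: "runs ?loop (nwrite c 0 0 s) (N * (T + 2) + 1) Q"
    by (rule runs_mono) (use final in auto)
  show ?thesis
    unfolding for_loop_def
    by (rule runs_Seq[where T = 1], rule runs_loop_free) (use loop time in auto)
qed

text \<open>A frame condition with the granularity of whole arrays: the sets list the arrays of
  naturals and of reals that may have been written.\<close>

definition unchanged :: "nat set \<Rightarrow> nat set \<Rightarrow> store \<Rightarrow> store \<Rightarrow> bool" where
  "unchanged A B s s' \<longleftrightarrow> (\<forall>a. a \<notin> A \<longrightarrow> nmem s' a = nmem s a) \<and> (\<forall>a. a \<notin> B \<longrightarrow> rmem s' a = rmem s a)"

lemma unchanged_refl: "unchanged A B s s"
  by (simp add: unchanged_def)

lemma unchanged_trans:
  "unchanged A B s s' \<Longrightarrow> unchanged A' B' s' s'' \<Longrightarrow> A \<subseteq> C \<Longrightarrow> A' \<subseteq> C \<Longrightarrow> B \<subseteq> D \<Longrightarrow> B' \<subseteq> D \<Longrightarrow>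
   unchanged C D s s''"
  unfolding unchanged_def by (metis subsetD)

lemma unchanged_nwrite [simp]: "a \<in> A \<Longrightarrow> unchanged A B s (nwrite a j x s') = unchanged A B s s'"
  by (auto simp: unchanged_def)

lemma unchanged_rwrite [simp]: "a \<in> B \<Longrightarrow> unchanged A B s (rwrite a j x s') = unchanged A B s s'"
  by (auto simp: unchanged_def)

lemma unchanged_nmem: "unchanged A B s s' \<Longrightarrow> a \<notin> A \<Longrightarrow> nmem s' a = nmem s a"
  by (simp add: unchanged_def)

lemma unchanged_rmem: "unchanged A B s s' \<Longrightarrow> a \<notin> B \<Longrightarrow> rmem s' a = rmem s a"
  by (simp add: unchanged_def)


section \<open>The program\<close>

definition code :: "player \<Rightarrow> nat" where
  "code i = (case i of P1 \<Rightarrow> 1 | P2 \<Rightarrow> 2)"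

definition cost_array :: "player \<Rightarrow> nat" where
  "cost_array i = (case i of P1 \<Rightarrow> 0 | P2 \<Rightarrow> 1)"

abbreviation ncell :: "nat \<Rightarrow> nexp" where
  "ncell a \<equiv> NRead a (NConst 0)"

abbreviation vert_count :: nexp where
  "vert_count \<equiv> NRead 0 (NConst 0)"

abbreviation arc_count :: nexp where
  "arc_count \<equiv> NRead 0 (NConst 1)"

abbreviation arc_tail :: nexp where
  "arc_tail \<equiv> NRead 2 (ncell 6)"

abbreviation arc_head :: nexp where
  "arc_head \<equiv> NRead 3 (ncell 6)"

abbreviation cap_cell :: rexp where
  "cap_cell \<equiv> RRead 2 (NConst 0)"

definition NEq :: "nexp \<Rightarrow> nexp \<Rightarrow> bexp" where
  "NEq x y = BAnd (BNot (NLess x y)) (BNot (NLess y x))"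

lemma bval_NEq [simp]: "bval (NEq x y) s \<longleftrightarrow> nval x s = nval y s"
  by (auto simp: NEq_def)

definition permitted :: "nat \<Rightarrow> bexp" where
  "permitted R = BNot (BAnd (NLess (NConst 0) (NRead R arc_tail))
     (BNot (NEq (NRead R arc_tail) (NAdd (ncell 6) (NConst 1)))))"

lemma bval_permitted [simp]:
  "bval (permitted R) s \<longleftrightarrow> nmem s R (nmem s 2 (nmem s 6 0)) \<in> {0, Suc (nmem s 6 0)}"
  by (auto simp: permitted_def)

text \<open>
  Array 5 of naturals holds the number of the round, 6 the counter of the inner loops, \<open>R\<close> the
  restriction of the arcs (at a vertex, 0 stands for no restriction and \<open>e + 1\<close> for the single arc
  \<open>e\<close>) and \<open>N\<close> the greedy arcs. Array 2 of reals holds the cap, 3 the values of the previous round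
  and \<open>V\<close> the values. The equilibrium is assembled with the restriction in array 7, the answer of
  the opponent in 10 and the current vertex of the path in 11; array 12 stays 0 and serves as the
  empty restriction.
\<close>
definition prepare_arcs :: "player \<Rightarrow> nat \<Rightarrow> nat \<Rightarrow> com" where
  "prepare_arcs i R N =
     Seq (RAssign 2 (NConst 0) RZero)
       (for_loop 6 arc_count
         (Seq (RAssign 2 (NConst 0)
                (RAdd cap_cell (RAdd (RRead (cost_array i) (ncell 6)) (RRead (cost_array i) (ncell 6)))))
            (Cond (permitted R) (NAssign N arc_tail (ncell 6)) Skip)))"

definition prepare_values :: "nat \<Rightarrow> com" where
  "prepare_values V =
     for_loop 6 vert_count
       (Cond (NEq (NRead 1 (ncell 6)) (NConst 0))
         (RAssign V (ncell 6) RZero) (RAssign V (ncell 6) cap_cell))"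

text \<open>The values written to \<open>V\<close> are \<open>bellman\<close> for the empty arc set,
  the neutral start of the running minimum or maximum. The old values are first saved in array 3, so
  that all updates of a round use the same previous round.\<close>

definition reset_values :: "player \<Rightarrow> nat \<Rightarrow> com" where
  "reset_values i V =
     for_loop 6 vert_count
       (Seq (RAssign 3 (ncell 6) (RRead V (ncell 6)))
         (Cond (NEq (NRead 1 (ncell 6)) (NConst (code i)))
           (RAssign V (ncell 6) cap_cell) (RAssign V (ncell 6) RZero)))"

text \<open>Each arc updates the value at its tail, so one scan of the arc list replaces a separate
  search for the outgoing arcs of every vertex.\<close>

definition relax_arcs :: "player \<Rightarrow> nat \<Rightarrow> nat \<Rightarrow> com" where
  "relax_arcs i R V =
     for_loop 6 arc_count
       (let w = RAdd (RRead (cost_array i) (ncell 6)) (RRead 3 arc_head); v = RRead V arc_tail in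
        Cond (permitted R)
          (Cond (NEq (NRead 1 arc_tail) (NConst (code i)))
            (Cond (RLess w v) (RAssign V arc_tail w) Skip)
            (Cond (RLess v w)
              (Cond (RLess w cap_cell) (RAssign V arc_tail w) (RAssign V arc_tail cap_cell)) Skip))
          Skip)"

definition iterate_values :: "player \<Rightarrow> nat \<Rightarrow> nat \<Rightarrow> com" where
  "iterate_values i R V = for_loop 5 vert_count (Seq (reset_values i V) (relax_arcs i R V))"

text \<open>\<open>N\<close> already contains some permitted arc at each vertex that is the tail of
  one, left by \<open>prepare_arcs\<close>. It survives where no arc passes the test, which can
  happen at a minimizing vertex whose value is cut off.\<close>

definition select_arcs :: "player \<Rightarrow> nat \<Rightarrow> nat \<Rightarrow> nat \<Rightarrow> com" where
  "select_arcs i R V N =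
     for_loop 6 arc_count
       (let w = RAdd (RRead (cost_array i) (ncell 6)) (RRead V arc_head); v = RRead V arc_tail in
        Cond (permitted R)
          (Cond (NEq (NRead 1 arc_tail) (NConst (code i)))
            (Cond (RLess v w) Skip (NAssign N arc_tail (ncell 6)))
            (Cond (RLess w v) Skip (NAssign N arc_tail (ncell 6))))
          Skip)"

definition solve :: "player \<Rightarrow> nat \<Rightarrow> nat \<Rightarrow> nat \<Rightarrow> com" where
  "solve i R V N =
     Seq (prepare_arcs i R N)
       (Seq (prepare_values V) (Seq (iterate_values i R V) (select_arcs i R V N)))"

definition fix_arcs :: "player \<Rightarrow> nat \<Rightarrow> com" where
  "fix_arcs q N =
     for_loop 6 vert_count
       (Seq (NAssign 4 (ncell 6) (NRead N (ncell 6)))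
         (Cond (NEq (NRead 1 (ncell 6)) (NConst (code q)))
           (NAssign 7 (ncell 6) (NAdd (NRead N (ncell 6)) (NConst 1))) Skip))"

text \<open>Array 4 initially holds \<open>a\<close>. The move is read from array 4 after the arc of
  \<open>b\<close> has been stored, so it follows \<open>b\<close> at vertices of \<open>p\<close>
  and \<open>a\<close>, which equals \<open>b\<close>, at the other nonterminal ones.\<close>

definition follow_path :: "player \<Rightarrow> com" where
  "follow_path p =
     Seq (NAssign 11 (NConst 0) (NRead 0 (NConst 2)))
       (for_loop 6 vert_count
         (Cond (NEq (NRead 1 (ncell 11)) (NConst 0)) Skip
           (Seq
             (Cond (NEq (NRead 1 (ncell 11)) (NConst (code p)))
               (NAssign 4 (ncell 11) (NRead 10 (ncell 11))) Skip)
             (NAssign 11 (NConst 0) (NRead 3 (NRead 4 (ncell 11)))))))"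

definition path_equilibrium :: "player \<Rightarrow> nat \<Rightarrow> com" where
  "path_equilibrium q N =
     Seq (fix_arcs q N) (Seq (solve (opponent q) 7 6 10) (follow_path (opponent q)))"

definition blocked_equilibrium :: com where
  "blocked_equilibrium =
     for_loop 6 vert_count
       (Cond (NEq (NRead 1 (ncell 6)) (NConst (code P1)))
         (NAssign 4 (ncell 6) (NRead 9 (ncell 6))) (NAssign 4 (ncell 6) (NRead 8 (ncell 6))))"

text \<open>Each call of \<open>solve\<close> overwrites the cap, so each test directly follows its
  own call. Array 8 survives the second call for use in the blocked case.\<close>

definition equilibrium_program :: com where
  "equilibrium_program =
     Seq (solve P1 12 4 8)
       (Cond (RLess (RRead 4 (NRead 0 (NConst 2))) cap_cell) (path_equilibrium P1 8)
         (Seq (solve P2 12 5 9)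
           (Cond (RLess (RRead 5 (NRead 0 (NConst 2))) cap_cell) (path_equilibrium P2 9)
             blocked_equilibrium)))"


section \<open>Correctness of the program\<close>

definition holds_input :: "(nat, nat) sp_game \<Rightarrow> store \<Rightarrow> bool" where
  "holds_input G s \<longleftrightarrow>
     (\<forall>a \<le> 3. nmem s a = nmem (game_input G) a) \<and> (\<forall>a \<le> 1. rmem s a = rmem (game_input G) a)"

definition permitted_arcs :: "(nat, nat) sp_game \<Rightarrow> nat \<Rightarrow> store \<Rightarrow> nat set" where
  "permitted_arcs G R s = {e \<in> arcs (graph G). nmem s R (tail (graph G) e) \<in> {0, Suc e}}"

lemma holds_input_unchanged:
  assumes "holds_input G s" "unchanged A B s s'" "A \<inter> {..3} = {}" "B \<inter> {..1} = {}"
  shows "holds_input G s'"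
  using assms unfolding holds_input_def unchanged_def by (metis atMost_iff disjoint_iff)

lemma permitted_arcs_unchanged:
  "unchanged A B s s' \<Longrightarrow> R \<notin> A \<Longrightarrow> permitted_arcs G R s' = permitted_arcs G R s"
  by (simp add: permitted_arcs_def unchanged_def)

section \<open>Numbered games in memory\<close>

locale numbered_game = positive_game G for G :: "(nat, nat) sp_game" +
  assumes numbered: "numbered G"
begin

abbreviation n :: nat where "n \<equiv> card (verts (graph G))"
abbreviation m :: nat where "m \<equiv> card (arcs (graph G))"

lemma verts_eq: "x \<in> verts (graph G) \<longleftrightarrow> x < n"
  using numbered by (auto simp: numbered_def)

lemma arcs_eq: "e \<in> arcs (graph G) \<longleftrightarrow> e < m"
  using numbered by (auto simp: numbered_def)

lemma tail_less: "e < m \<Longrightarrow> tail (graph G) e < n"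
  using tail_in_verts[of e] by (simp add: verts_eq arcs_eq)

lemma head_less: "e < m \<Longrightarrow> head (graph G) e < n"
  using head_in_verts[of e] by (simp add: verts_eq arcs_eq)

lemma input_counts:
  assumes "holds_input G s"
  shows "nmem s 0 0 = n" "nmem s 0 (Suc 0) = m" "nmem s 0 2 = init G"
  using assms by (simp_all add: holds_input_def game_input_def Let_def)

lemma input_owner:
  assumes "holds_input G s" "x < n"
  shows "nmem s (Suc 0) x = code i \<longleftrightarrow> x \<in> ctrl G i" "nmem s (Suc 0) x = 0 \<longleftrightarrow> x \<in> terminals G"
proof -
  have own: "nmem s (Suc 0) x = (if x \<in> ctrl G P1 then 1 else if x \<in> ctrl G P2 then 2 else 0)"
    using assms by (simp add: holds_input_def game_input_def Let_def)
  show "nmem s (Suc 0) x = code i \<longleftrightarrow> x \<in> ctrl G i"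
    using own ctrl_opponent[of x P1] by (cases i) (auto simp: code_def opponent_def)
  show "nmem s (Suc 0) x = 0 \<longleftrightarrow> x \<in> terminals G"
  proof (cases "x \<in> terminals G")
    case True
    then have "x \<notin> ctrl G P1" "x \<notin> ctrl G P2" using ctrl_vert by auto
    then show ?thesis using own True by simp
  next
    case False
    from ctrl_cases[OF _ this, of P1] assms(2)
    have "x \<in> ctrl G P1 \<or> x \<in> ctrl G P2" by (auto simp: verts_eq opponent_def)
    then show ?thesis using own False by auto
  qed
qed

lemma input_arc:
  assumes "holds_input G s" "e < m"
  shows "nmem s 2 e = tail (graph G) e" "nmem s 3 e = head (graph G) e"
    "rmem s (cost_array i) e = cost G i e"
  using assms by (cases i; simp add: holds_input_def game_input_def Let_def cost_array_def)+

lemma cost_array_neq [simp]: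
  "cost_array i \<noteq> 2" "cost_array i \<noteq> 3" "cost_array i \<noteq> 4" "cost_array i \<noteq> 5" "cost_array i \<noteq> 6"
  by (cases i; simp add: cost_array_def)+

text \<open>One additional arc affects only its tail, by a single minimum or maximum. This is the
  update made by \<open>relax_arcs\<close>.\<close>

lemma bellman_insert:
  assumes "E \<subseteq> arcs (graph G)"
  shows "bellman G i (insert e E) w x =
    (if tail (graph G) e \<noteq> x then bellman G i E w x
     else if x \<in> ctrl G i then min (bellman G i E w x) (arc_value G i w e)
     else max (bellman G i E w x) (min (cap G i) (arc_value G i w e)))"
proof -
  let ?A = "{e' \<in> E. tail (graph G) e' = x}"
  let ?f = "arc_value G i w" and ?g = "\<lambda>e. min (cap G i) (arc_value G i w e)"
  have fin: "finite ?A" by (rule finite_E[OF assms])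
  show ?thesis
  proof (cases "tail (graph G) e = x")
    case True
    have ins: "{e' \<in> insert e E. tail (graph G) e' = x} = insert e ?A" using True by auto
    have Min: "Min (insert (cap G i) (?f ` insert e ?A)) = min (?f e) (Min (insert (cap G i) (?f ` ?A)))"
      using Min_insert[of "insert (cap G i) (?f ` ?A)" "?f e"] fin
      by (simp only: image_insert insert_commute finite_insert finite_imageI insert_not_empty not_False_eq_True)
    have Max: "Max (insert 0 (?g ` insert e ?A)) = max (?g e) (Max (insert 0 (?g ` ?A)))"
      using Max_insert[of "insert 0 (?g ` ?A)" "?g e"] fin
      by (simp only: image_insert insert_commute finite_insert finite_imageI insert_not_empty not_False_eq_True)
    show ?thesis
    proof (cases "x \<in> ctrl G i")
      case c: True
      show ?thesis unfolding bellman_def ins Min using True c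
        by (simp only: if_True if_False simp_thms min.commute)
    next
      case c: False
      show ?thesis unfolding bellman_def ins Max using True c
        by (simp only: if_True if_False simp_thms max.commute)
    qed
  next
    case False
    then have "{e' \<in> insert e E. tail (graph G) e' = x} = ?A" by auto
    then show ?thesis using False by (simp only: bellman_def if_True simp_thms)
  qed
qed

lemma prepare_arcs_correct:
  assumes input: "holds_input G s" and E: "E = permitted_arcs G R s" and N: "N \<in> {8, 9, 10}" "R \<in> {7, 12}"
  shows "runs (prepare_arcs i R N) s (7 * m + 3)
    (\<lambda>s'. unchanged {6, N} {2} s s' \<and> rmem s' 2 0 = cap G i \<and>
      (\<forall>e \<in> E. nmem s' N (tail (graph G) e) \<in> E \<and>
        tail (graph G) (nmem s' N (tail (graph G) e)) = tail (graph G) e))"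
proof -
  define I where "I k s' \<longleftrightarrow> unchanged {6, N} {2} s s' \<and> rmem s' 2 0 = (\<Sum>e<k. cost G i e + cost G i e) \<and>
      (\<forall>e \<in> E. e < k \<longrightarrow> nmem s' N (tail (graph G) e) \<in> E \<and>
        tail (graph G) (nmem s' N (tail (graph G) e)) = tail (graph G) e)" for k s'
  have neq: "N \<noteq> 6" "6 \<noteq> N" "N \<noteq> R" using N by auto
  have input': "holds_input G s'" if "unchanged {6, N} {2} s s'" for s'
    by (rule holds_input_unchanged[OF input that]) (use N in auto)
  have R': "nmem s' R = nmem s R" if "unchanged {6, N} {2} s s'" for s'
    by (rule unchanged_nmem[OF that]) (use N in auto)
  have "arcs (graph G) = {..<m}" using arcs_eq by auto
  then have cap: "cap G i = (\<Sum>e<m. cost G i e + cost G i e)"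
    unfolding cap_def by (rule sum.cong) simp
  have E_less: "e < m" if "e \<in> E" for e
    using that arcs_eq by (auto simp: E permitted_arcs_def)
  show ?thesis
    unfolding prepare_arcs_def
  proof (rule runs_Seq[where T = 1], rule runs_loop_free)
    show "runs (for_loop 6 arc_count
        (Seq (RAssign 2 (NConst 0)
               (RAdd cap_cell (RAdd (RRead (cost_array i) (ncell 6)) (RRead (cost_array i) (ncell 6)))))
           (Cond (permitted R) (NAssign N arc_tail (ncell 6)) Skip)))
       (effect (RAssign 2 (NConst 0) RZero) s) (7 * m + 2)
       (\<lambda>s'. unchanged {6, N} {2} s s' \<and> rmem s' 2 0 = cap G i \<and>
         (\<forall>e \<in> E. nmem s' N (tail (graph G) e) \<in> E \<and>
           tail (graph G) (nmem s' N (tail (graph G) e)) = tail (graph G) e))"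
    proof (rule runs_for_loop[where I = I and N = m and T = 5])
      show "I 0 (nwrite 6 0 0 (effect (RAssign 2 (NConst 0) RZero) s))"
        by (simp add: I_def unchanged_refl)
      show "nval arc_count s' = m" if "I k s'" for k s'
        using that input' by (simp add: I_def input_counts)
      show "I m s' \<Longrightarrow> unchanged {6, N} {2} s s' \<and> rmem s' 2 0 = cap G i \<and>
         (\<forall>e \<in> E. nmem s' N (tail (graph G) e) \<in> E \<and>
           tail (graph G) (nmem s' N (tail (graph G) e)) = tail (graph G) e)" for s'
        using E_less by (simp add: I_def cap)
    next
      fix k s'
      assume k: "k < m" and I: "I k s'" and ctr: "nmem s' 6 0 = k"
      have inp: "holds_input G s'" using I input' by (simp add: I_def)
      have perm: "nmem s' R (tail (graph G) k) = 0 \<or> nmem s' R (tail (graph G) k) = Suc k \<longleftrightarrow> k \<in> E"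
        using k I R' arcs_eq by (auto simp: E permitted_arcs_def I_def)
      have eff: "effect (Seq (RAssign 2 (NConst 0)
               (RAdd cap_cell (RAdd (RRead (cost_array i) (ncell 6)) (RRead (cost_array i) (ncell 6)))))
           (Cond (permitted R) (NAssign N arc_tail (ncell 6)) Skip)) s' =
         (let s'' = rwrite 2 0 (rmem s' 2 0 + (cost G i k + cost G i k)) s' in
           if k \<in> E then nwrite N (tail (graph G) k) k s'' else s'')"
        by (simp add: ctr input_arc[OF inp k] perm)
      show "runs (Seq (RAssign 2 (NConst 0)
               (RAdd cap_cell (RAdd (RRead (cost_array i) (ncell 6)) (RRead (cost_array i) (ncell 6)))))
           (Cond (permitted R) (NAssign N arc_tail (ncell 6)) Skip)) s' 5
         (\<lambda>s'. nmem s' 6 0 = k \<and> I (Suc k) (nwrite 6 0 (Suc k) s'))"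
        by (rule runs_loop_free)
          (use I ctr neq in \<open>unfold eff, auto simp: I_def less_Suc_eq Let_def\<close>)
    qed simp
  qed simp_all
qed

lemma bellman_no_arcs: "bellman G i {} w x = (if x \<in> ctrl G i then cap G i else 0)"
  by (simp add: bellman_def)

lemma bellman_step:
  assumes "E \<subseteq> arcs (graph G)" "k \<in> E"
  shows "bellman G i (E \<inter> {..<Suc k}) w x =
    (if tail (graph G) k \<noteq> x then bellman G i (E \<inter> {..<k}) w x
     else if x \<in> ctrl G i then min (bellman G i (E \<inter> {..<k}) w x) (arc_value G i w k)
     else max (bellman G i (E \<inter> {..<k}) w x) (min (cap G i) (arc_value G i w k)))"
proof -
  have "E \<inter> {..<Suc k} = insert k (E \<inter> {..<k})" using assms(2) by auto
  moreover have "E \<inter> {..<k} \<subseteq> arcs (graph G)" using assms(1) by auto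
  ultimately show ?thesis by (simp only: bellman_insert)
qed

lemma prepare_values_correct:
  assumes input: "holds_input G s" and cap: "rmem s 2 0 = cap G i" and V: "V \<in> {4, 5, 6}"
  shows "runs (prepare_values V) s (4 * n + 2)
    (\<lambda>s'. unchanged {6} {V} s s' \<and> (\<forall>x<n. rmem s' V x = value_iter G i E 0 x))"
proof -
  define I where "I k s' \<longleftrightarrow> unchanged {6} {V} s s' \<and> (\<forall>x<k. rmem s' V x = value_iter G i E 0 x)" for k s'
  have neq: "2 \<noteq> V" "V \<noteq> 2" using V by auto
  have input': "holds_input G s'" if "unchanged {6} {V} s s'" for s'
    by (rule holds_input_unchanged[OF input that]) (use V in auto)
  show ?thesis
    unfolding prepare_values_def
  proof (rule runs_for_loop[where I = I and N = n and T = 2])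
    show "nval vert_count s' = n" if "I k s'" for k s'
      using that input' by (simp add: I_def input_counts)
  next
    fix k s'
    assume k: "k < n" and I: "I k s'" and ctr: "nmem s' 6 0 = k"
    have inp: "holds_input G s'" using I input' by (simp add: I_def)
    have "rmem s' 2 = rmem s 2" using I neq unfolding I_def by (intro unchanged_rmem) auto
    then have cap': "rmem s' 2 0 = cap G i" using cap by simp
    have eff: "effect (Cond (NEq (NRead 1 (ncell 6)) (NConst 0))
         (RAssign V (ncell 6) RZero) (RAssign V (ncell 6) cap_cell)) s' =
       rwrite V k (value_iter G i E 0 k) s'"
      using input_owner(2)[OF inp k] by (simp add: ctr cap')
    show "runs (Cond (NEq (NRead 1 (ncell 6)) (NConst 0))
         (RAssign V (ncell 6) RZero) (RAssign V (ncell 6) cap_cell)) s' 2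
       (\<lambda>s'. nmem s' 6 0 = k \<and> I (Suc k) (nwrite 6 0 (Suc k) s'))"
      by (rule runs_loop_free)
        (use I ctr in \<open>unfold eff, auto simp: I_def less_Suc_eq simp del: value_iter.simps\<close>)
  qed (auto simp: I_def unchanged_refl)
qed

lemma reset_values_correct:
  assumes input: "holds_input G s" and cap: "rmem s 2 0 = cap G i" and V: "V \<in> {4, 5, 6}"
    and w: "\<forall>x<n. rmem s V x = w x"
  shows "runs (reset_values i V) s (5 * n + 2)
    (\<lambda>s'. unchanged {6} {3, V} s s' \<and> (\<forall>x<n. rmem s' 3 x = w x \<and> rmem s' V x = bellman G i {} w x))"
proof -
  define I where "I k s' \<longleftrightarrow> unchanged {6} {3, V} s s' \<and>
    (\<forall>x<k. rmem s' 3 x = w x \<and> rmem s' V x = bellman G i {} w x) \<and>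
    (\<forall>x. k \<le> x \<longrightarrow> x < n \<longrightarrow> rmem s' V x = w x)" for k s'
  have neq: "2 \<noteq> V" "V \<noteq> 2" "V \<noteq> 3" "3 \<noteq> V" using V by auto
  have input': "holds_input G s'" if "unchanged {6} {3, V} s s'" for s'
    by (rule holds_input_unchanged[OF input that]) (use V in auto)
  show ?thesis
    unfolding reset_values_def
  proof (rule runs_for_loop[where I = I and N = n and T = 3])
    show "nval vert_count s' = n" if "I k s'" for k s'
      using that input' by (simp add: I_def input_counts)
  next
    fix k s'
    assume k: "k < n" and I: "I k s'" and ctr: "nmem s' 6 0 = k"
    have inp: "holds_input G s'" using I input' by (simp add: I_def)
    have "rmem s' 2 = rmem s 2" using I neq unfolding I_def by (intro unchanged_rmem) auto
    then have cap': "rmem s' 2 0 = cap G i" using cap by simp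
    have Vk: "rmem s' V k = w k" using I k by (simp add: I_def)
    have eff: "effect (Seq (RAssign 3 (ncell 6) (RRead V (ncell 6)))
         (Cond (NEq (NRead 1 (ncell 6)) (NConst (code i)))
           (RAssign V (ncell 6) cap_cell) (RAssign V (ncell 6) RZero))) s' =
       rwrite V k (bellman G i {} w k) (rwrite 3 k (w k) s')"
      using input_owner(1)[OF inp k] neq by (simp add: ctr cap' Vk bellman_no_arcs)
    show "runs (Seq (RAssign 3 (ncell 6) (RRead V (ncell 6)))
         (Cond (NEq (NRead 1 (ncell 6)) (NConst (code i)))
           (RAssign V (ncell 6) cap_cell) (RAssign V (ncell 6) RZero))) s' 3
       (\<lambda>s'. nmem s' 6 0 = k \<and> I (Suc k) (nwrite 6 0 (Suc k) s'))"
      by (rule runs_loop_free) (use I ctr neq in \<open>unfold eff, auto simp: I_def less_Suc_eq\<close>)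
  qed (use w in \<open>auto simp: I_def unchanged_refl\<close>)
qed

lemma relax_arcs_correct:
  assumes input: "holds_input G s" and cap: "rmem s 2 0 = cap G i" and V: "V \<in> {4, 5, 6}" "R \<in> {7, 12}"
    and E: "E = permitted_arcs G R s"
    and w: "\<forall>x<n. rmem s 3 x = w x \<and> rmem s V x = bellman G i {} w x"
  shows "runs (relax_arcs i R V) s (7 * m + 2)
    (\<lambda>s'. unchanged {6} {V} s s' \<and> (\<forall>x<n. rmem s' V x = bellman G i E w x))"
proof -
  define I where "I k s' \<longleftrightarrow> unchanged {6} {V} s s' \<and>
    (\<forall>x<n. rmem s' V x = bellman G i (E \<inter> {..<k}) w x)" for k s'
  have neq: "2 \<noteq> V" "V \<noteq> 2" "V \<noteq> 3" "3 \<noteq> V" "cost_array i \<noteq> V" "V \<noteq> cost_array i"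
    using V by (cases i; auto simp: cost_array_def)+
  have input': "holds_input G s'" if "unchanged {6} {V} s s'" for s'
    by (rule holds_input_unchanged[OF input that]) (use V in auto)
  have E_arcs: "E \<subseteq> arcs (graph G)" by (auto simp: E permitted_arcs_def)
  then have "E \<inter> {..<m} = E" using arcs_eq by auto
  show ?thesis
    unfolding relax_arcs_def Let_def
  proof (rule runs_for_loop[where I = I and N = m and T = 5])
    show "nval arc_count s' = m" if "I k s'" for k s'
      using that input' by (simp add: I_def input_counts)
    show "I m s' \<Longrightarrow> unchanged {6} {V} s s' \<and> (\<forall>x<n. rmem s' V x = bellman G i E w x)" for s'
      using \<open>E \<inter> {..<m} = E\<close> by (simp add: I_def)
  next
    fix k s'
    assume k: "k < m" and I: "I k s'" and ctr: "nmem s' 6 0 = k"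
    have inp: "holds_input G s'" using I input' by (simp add: I_def)
    have u: "unchanged {6} {V} s s'" using I by (simp add: I_def)
    have "rmem s' 2 = rmem s 2" "rmem s' 3 = rmem s 3" "nmem s' R = nmem s R"
      using unchanged_rmem[OF u] unchanged_nmem[OF u] neq V(2) by auto
    then have cap': "rmem s' 2 0 = cap G i"
      and w': "rmem s' 3 (head (graph G) k) = w (head (graph G) k)"
      and perm: "nmem s' R (tail (graph G) k) = 0 \<or> nmem s' R (tail (graph G) k) = Suc k \<longleftrightarrow> k \<in> E"
      using cap w head_less[OF k] k arcs_eq by (auto simp: E permitted_arcs_def)
    let ?w = "RAdd (RRead (cost_array i) (ncell 6)) (RRead 3 arc_head)" and ?v = "RRead V arc_tail"
    let ?c = "Cond (permitted R)
          (Cond (NEq (NRead 1 arc_tail) (NConst (code i)))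
            (Cond (RLess ?w ?v) (RAssign V arc_tail ?w) Skip)
            (Cond (RLess ?v ?w)
              (Cond (RLess ?w cap_cell) (RAssign V arc_tail ?w) (RAssign V arc_tail cap_cell)) Skip))
          Skip"
    let ?x = "tail (graph G) k"
    have Vx: "rmem s' V ?x = bellman G i (E \<inter> {..<k}) w ?x"
      using I tail_less[OF k] by (simp add: I_def)
    \<comment> \<open>The maximizing branch writes the cap outright when the arc value reaches it;
      this agrees with the maximum because the stored value never exceeds the cap.\<close>
    have le_cap: "bellman G i (E \<inter> {..<k}) w ?x \<le> cap G i"
      using E_arcs by (intro bellman_le_cap) auto
    \<comment> \<open>With this, the branches that do nothing also count as writes at
      \<open>?x\<close>, and one formula describes all branches.\<close>
    have skip: "rwrite V ?x (rmem s' V ?x) s' = s'" by (simp add: rwrite_def)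
    have eff: "effect ?c s' = rwrite V ?x (bellman G i (E \<inter> {..<Suc k}) w ?x) s'"
    proof (cases "k \<in> E")
      case False
      then have "E \<inter> {..<Suc k} = E \<inter> {..<k}" by (auto simp: less_Suc_eq)
      then show ?thesis using False skip by (simp add: ctr input_arc[OF inp k] perm Vx)
    next
      case True
      have step: "bellman G i (E \<inter> {..<Suc k}) w ?x =
        (if ?x \<in> ctrl G i then min (bellman G i (E \<inter> {..<k}) w ?x) (arc_value G i w k)
         else max (bellman G i (E \<inter> {..<k}) w ?x) (min (cap G i) (arc_value G i w k)))"
        using bellman_step[OF E_arcs, of k] True by simp
      have val: "rval ?w s' = arc_value G i w k"
        by (simp add: ctr input_arc[OF inp k] w' arc_value_def)
      have own: "nmem s' (Suc 0) ?x = code i \<longleftrightarrow> ?x \<in> ctrl G i"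
        by (rule input_owner(1)[OF inp tail_less[OF k]])
      let ?b = "bellman G i (E \<inter> {..<k}) w ?x" and ?a = "arc_value G i w k"
      have opt: "min ?b ?a = (if ?a < ?b then ?a else ?b)"
        "max ?b (min (cap G i) ?a) = (if ?b < ?a then if ?a < cap G i then ?a else cap G i else ?b)"
        using le_cap by (auto simp: min_def max_def)
      have perm': "bval (permitted R) s'" using True by (simp add: ctr input_arc[OF inp k] perm)
      have own': "bval (NEq (NRead 1 arc_tail) (NConst (code i))) s' \<longleftrightarrow> ?x \<in> ctrl G i"
        by (simp add: ctr input_arc[OF inp k] own)
      have vals: "rval ?v s' = ?b" "rval cap_cell s' = cap G i" "nval arc_tail s' = ?x"
        by (simp_all add: ctr input_arc[OF inp k] Vx cap')
      show ?thesis
        using skip unfolding step opt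
        by (simp only: effect.simps bval.simps perm' own' val vals Vx if_True if_False split: if_split) simp
    qed
    show "runs ?c s' 5 (\<lambda>s'. nmem s' 6 0 = k \<and> I (Suc k) (nwrite 6 0 (Suc k) s'))"
    proof (rule runs_loop_free)
      have "bellman G i (E \<inter> {..<Suc k}) w x = bellman G i (E \<inter> {..<k}) w x" if "x \<noteq> ?x" for x
      proof (cases "k \<in> E")
        case True
        then show ?thesis using bellman_step[OF E_arcs, of k] that by simp
      next
        case False
        then have "E \<inter> {..<Suc k} = E \<inter> {..<k}" by (auto simp: less_Suc_eq)
        then show ?thesis by simp
      qed
      then show "nmem (effect ?c s') 6 0 = k \<and> I (Suc k) (nwrite 6 0 (Suc k) (effect ?c s'))"
        unfolding eff using I ctr by (simp add: I_def)
    qed simp_all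
  qed (use w in \<open>auto simp: I_def unchanged_refl\<close>)
qed

lemma iterate_values_correct:
  assumes input: "holds_input G s" and cap: "rmem s 2 0 = cap G i" and V: "V \<in> {4, 5, 6}" "R \<in> {7, 12}"
    and E: "E = permitted_arcs G R s"
    and v: "\<forall>x<n. rmem s V x = value_iter G i E 0 x"
  shows "runs (iterate_values i R V) s (n * (5 * n + 7 * m + 6) + 2)
    (\<lambda>s'. unchanged {5, 6} {3, V} s s' \<and> (\<forall>x<n. rmem s' V x = game_value G i E x))"
proof -
  define I where "I k s' \<longleftrightarrow> unchanged {5, 6} {3, V} s s' \<and>
    (\<forall>x<n. rmem s' V x = value_iter G i E k x)" for k s'
  have input': "holds_input G s'" if "unchanged {5, 6} {3, V} s s'" for s'
    by (rule holds_input_unchanged[OF input that]) (use V in auto)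
  show ?thesis
    unfolding iterate_values_def
  proof (rule runs_for_loop[where I = I and N = n and T = "5 * n + 7 * m + 4"])
    show "nval vert_count s' = n" if "I k s'" for k s'
      using that input' by (simp add: I_def input_counts)
    show "I n s' \<Longrightarrow> unchanged {5, 6} {3, V} s s' \<and> (\<forall>x<n. rmem s' V x = game_value G i E x)" for s'
      by (simp add: I_def game_value_def)
  next
    fix k s1
    assume I: "I k s1" and ctr: "nmem s1 5 0 = k"
    let ?w = "value_iter G i E k"
    have u1: "unchanged {5, 6} {3, V} s s1" using I by (simp add: I_def)
    have cap1: "rmem s1 2 0 = cap G i" using cap unchanged_rmem[OF u1, of 2] V by auto
    have w1: "\<forall>x<n. rmem s1 V x = ?w x" using I by (simp add: I_def)
    show "runs (Seq (reset_values i V) (relax_arcs i R V)) s1 (5 * n + 7 * m + 4)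
      (\<lambda>s'. nmem s' 5 0 = k \<and> I (Suc k) (nwrite 5 0 (Suc k) s'))"
    proof (rule runs_Seq[where T = "5 * n + 2" and T' = "7 * m + 2"], rule runs_mono[OF reset_values_correct[OF input'[OF u1] cap1 V(1) w1]])
      fix s2 assume 2: "unchanged {6} {3, V} s1 s2 \<and>
        (\<forall>x<n. rmem s2 3 x = ?w x \<and> rmem s2 V x = bellman G i {} ?w x)"
      have u2: "unchanged {5, 6} {3, V} s s2"
        by (rule unchanged_trans[OF u1 conjunct1[OF 2]]) auto
      have cap2: "rmem s2 2 0 = cap G i" using cap unchanged_rmem[OF u2, of 2] V by auto
      have E2: "E = permitted_arcs G R s2"
        using permitted_arcs_unchanged[OF u2, of R] V E by auto
      show "runs (relax_arcs i R V) s2 (7 * m + 2) (\<lambda>s'. nmem s' 5 0 = k \<and> I (Suc k) (nwrite 5 0 (Suc k) s'))"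
      proof (rule runs_mono[OF relax_arcs_correct[OF input'[OF u2] cap2 V E2 conjunct2[OF 2]] _ order_refl])
        fix s3 assume 3: "unchanged {6} {V} s2 s3 \<and> (\<forall>x<n. rmem s3 V x = bellman G i E ?w x)"
        have "unchanged {5, 6} {3, V} s s3"
          by (rule unchanged_trans[OF u2 conjunct1[OF 3]]) auto
        moreover have "nmem s3 5 0 = k"
          using ctr 2 3 unchanged_nmem[of "{6}" "{V}" s2 s3 5] unchanged_nmem[of "{6}" "{3, V}" s1 s2 5] by simp
        ultimately show "nmem s3 5 0 = k \<and> I (Suc k) (nwrite 5 0 (Suc k) s3)"
          using 3 by (simp add: I_def)
      qed
    qed simp_all
  qed (use v in \<open>auto simp: I_def unchanged_refl simp del: value_iter.simps\<close>)
qed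

lemma select_arcs_correct:
  assumes input: "holds_input G s" and V: "V \<in> {4, 5, 6}" "R \<in> {7, 12}" "N \<in> {8, 9, 10}"
    and E: "E = permitted_arcs G R s" "admissible G E"
    and v: "\<forall>x<n. rmem s V x = game_value G i E x"
    and N: "\<forall>e \<in> E. nmem s N (tail (graph G) e) \<in> E \<and>
      tail (graph G) (nmem s N (tail (graph G) e)) = tail (graph G) e"
  shows "runs (select_arcs i R V N) s (6 * m + 2)
    (\<lambda>s'. unchanged {6, N} {} s s' \<and> greedy G i E (game_value G i E) (nmem s' N))"
proof -
  let ?v = "game_value G i E"
  \<comment> \<open>No exemption at the cap is built in, since the program tests the bare
    inequality. The invariant says that once a good arc has been scanned, the selected arc is good;
    at the end \<open>ex_greedy_arc\<close> supplies a good arc wherever \<open>greedy\<close> asks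
    for one.\<close>
  define good where "good e \<longleftrightarrow>
    (if tail (graph G) e \<in> ctrl G i then arc_value G i ?v e \<le> ?v (tail (graph G) e)
     else ?v (tail (graph G) e) \<le> arc_value G i ?v e)" for e
  define I where "I k s' \<longleftrightarrow> unchanged {6, N} {} s s' \<and>
    (\<forall>e \<in> E. nmem s' N (tail (graph G) e) \<in> E \<and>
      tail (graph G) (nmem s' N (tail (graph G) e)) = tail (graph G) e) \<and>
    (\<forall>e \<in> E. e < k \<longrightarrow> good e \<longrightarrow> good (nmem s' N (tail (graph G) e)))" for k s'
  have neq: "N \<noteq> 6" "6 \<noteq> N" "N \<noteq> R" using V by auto
  have input': "holds_input G s'" if "unchanged {6, N} {} s s'" for s'
    by (rule holds_input_unchanged[OF input that]) (use V in auto)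
  have E_less: "e < m" if "e \<in> E" for e
    using that arcs_eq by (auto simp: E permitted_arcs_def)
  have E_arcs: "E \<subseteq> arcs (graph G)" by (auto simp: E permitted_arcs_def)
  show ?thesis
    unfolding select_arcs_def Let_def
  proof (rule runs_for_loop[where I = I and N = m and T = 4])
    show "nval arc_count s' = m" if "I k s'" for k s'
      using that input' by (simp add: I_def input_counts)
  next
    fix k s'
    assume k: "k < m" and I: "I k s'" and ctr: "nmem s' 6 0 = k"
    have inp: "holds_input G s'" using I input' by (simp add: I_def)
    have u: "unchanged {6, N} {} s s'" using I by (simp add: I_def)
    have same: "rmem s' V = rmem s V" "nmem s' R = nmem s R"
      using unchanged_rmem[OF u] unchanged_nmem[OF u] neq V(2) by auto
    let ?x = "tail (graph G) k"
    have perm: "nmem s' R ?x = 0 \<or> nmem s' R ?x = Suc k \<longleftrightarrow> k \<in> E"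
      using same k arcs_eq by (auto simp: E permitted_arcs_def)
    have vals: "rmem s' V ?x = ?v ?x" "rmem s' V (head (graph G) k) = ?v (head (graph G) k)"
      using same v head_less[OF k] tail_less[OF k] by auto
    have own: "nmem s' (Suc 0) ?x = code i \<longleftrightarrow> ?x \<in> ctrl G i"
      by (rule input_owner(1)[OF inp tail_less[OF k]])
    let ?w = "RAdd (RRead (cost_array i) (ncell 6)) (RRead V arc_head)" and ?u = "RRead V arc_tail"
    let ?c = "Cond (permitted R)
          (Cond (NEq (NRead 1 arc_tail) (NConst (code i)))
            (Cond (RLess ?u ?w) Skip (NAssign N arc_tail (ncell 6)))
            (Cond (RLess ?w ?u) Skip (NAssign N arc_tail (ncell 6))))
          Skip"
    have eff: "effect ?c s' = (if k \<in> E \<and> good k then nwrite N ?x k s' else s')"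
      by (auto simp: ctr input_arc[OF inp k] perm own vals good_def arc_value_def)
    show "runs ?c s' 4 (\<lambda>s'. nmem s' 6 0 = k \<and> I (Suc k) (nwrite 6 0 (Suc k) s'))"
      by (rule runs_loop_free) (use I ctr neq in \<open>unfold eff, auto simp: I_def less_Suc_eq\<close>)
  next
    fix s' assume I: "I m s'"
    have "nmem s' N x \<in> E \<and> tail (graph G) (nmem s' N x) = x \<and>
        (if x \<in> ctrl G i then ?v x < cap G i \<longrightarrow> arc_value G i ?v (nmem s' N x) \<le> ?v x
         else ?v x \<le> arc_value G i ?v (nmem s' N x))" if x: "x \<in> verts (graph G) - terminals G" for x
    proof -
      obtain e where e: "e \<in> E" "tail (graph G) e = x"
        "if x \<in> ctrl G i then ?v x < cap G i \<longrightarrow> arc_value G i ?v e \<le> ?v x else ?v x \<le> arc_value G i ?v e"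
        using ex_greedy_arc[OF E_arcs E(2) x] by blast
      have N: "nmem s' N x \<in> E \<and> tail (graph G) (nmem s' N x) = x"
        using I e by (auto simp: I_def)
      have "good e \<longrightarrow> good (nmem s' N x)" using I e E_less by (auto simp: I_def)
      then show ?thesis using N e by (auto simp: good_def split: if_splits)
    qed
    then show "unchanged {6, N} {} s s' \<and> greedy G i E ?v (nmem s' N)"
      using I by (simp add: greedy_def I_def)
  qed (use N in \<open>auto simp: I_def unchanged_refl neq\<close>)
qed

lemma solve_correct:
  assumes input: "holds_input G s" and V: "V \<in> {4, 5, 6}" "R \<in> {7, 12}" "N \<in> {8, 9, 10}"
    and E: "E = permitted_arcs G R s" "admissible G E"
  shows "runs (solve i R V N) s (20 * (n + m + 1) ^ 2)
    (\<lambda>s'. unchanged {5, 6, N} {2, 3, V} s s' \<and> rmem s' 2 0 = cap G i \<and>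
      (\<forall>x<n. rmem s' V x = game_value G i E x) \<and> greedy G i E (game_value G i E) (nmem s' N))"
proof -
  let ?A = "{5, 6, N}" and ?B = "{2, 3, V}"
  let ?N = "\<lambda>s'. \<forall>e \<in> E. nmem s' N (tail (graph G) e) \<in> E \<and>
      tail (graph G) (nmem s' N (tail (graph G) e)) = tail (graph G) e"
  have input': "holds_input G s'" if "unchanged ?A ?B s s'" for s'
    by (rule holds_input_unchanged[OF input that]) (use V in auto)
  have E': "E = permitted_arcs G R s'" if "unchanged ?A ?B s s'" for s'
    using permitted_arcs_unchanged[OF that, of R] V E by auto
  have neq: "2 \<noteq> V" "N \<noteq> 5" "N \<noteq> 6" using V by auto
  \<comment> \<open>The quadratic part comes from \<open>n\<close> rounds, each scanning all
    vertices and all arcs. The factor 20 generously covers the linear terms as well.\<close>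
  have time: "7 * m + 3 + (4 * n + 2 + (n * (5 * n + 7 * m + 6) + 2 + (6 * m + 2))) \<le> 20 * (n + m + 1) ^ 2"
    by (simp add: power2_eq_square algebra_simps)
  show ?thesis
    unfolding solve_def
  proof (rule runs_Seq[OF runs_mono[OF prepare_arcs_correct[OF input E(1) V(3,2)] _ order_refl] time])
    fix s1 assume 1: "unchanged {6, N} {2} s s1 \<and> rmem s1 2 0 = cap G i \<and> ?N s1"
    have u1: "unchanged ?A ?B s s1"
      by (rule unchanged_trans[OF unchanged_refl[of "{}" "{}"] conjunct1[OF 1]]) auto
    show "runs (Seq (prepare_values V) (Seq (iterate_values i R V) (select_arcs i R V N))) s1
      (4 * n + 2 + (n * (5 * n + 7 * m + 6) + 2 + (6 * m + 2)))
      (\<lambda>s'. unchanged ?A ?B s s' \<and> rmem s' 2 0 = cap G i \<and>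
        (\<forall>x<n. rmem s' V x = game_value G i E x) \<and> greedy G i E (game_value G i E) (nmem s' N))"
    proof (rule runs_Seq[OF runs_mono[OF prepare_values_correct[OF input'[OF u1] _ V(1), of i E] _ order_refl] order_refl])
      show "rmem s1 2 0 = cap G i" using 1 by simp
    next
      fix s2 assume 2: "unchanged {6} {V} s1 s2 \<and> (\<forall>x<n. rmem s2 V x = value_iter G i E 0 x)"
      have u2: "unchanged ?A ?B s s2"
        by (rule unchanged_trans[OF u1 conjunct1[OF 2]]) auto
      have cap2: "rmem s2 2 0 = cap G i"
        using 1 unchanged_rmem[OF conjunct1[OF 2], of 2] neq by simp
      have N2: "?N s2" using 1 unchanged_nmem[OF conjunct1[OF 2], of N] neq by simp
      show "runs (Seq (iterate_values i R V) (select_arcs i R V N)) s2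
        (n * (5 * n + 7 * m + 6) + 2 + (6 * m + 2))
        (\<lambda>s'. unchanged ?A ?B s s' \<and> rmem s' 2 0 = cap G i \<and>
          (\<forall>x<n. rmem s' V x = game_value G i E x) \<and> greedy G i E (game_value G i E) (nmem s' N))"
      proof (rule runs_Seq[OF runs_mono[OF iterate_values_correct[OF input'[OF u2] cap2 V(1,2) E'[OF u2] conjunct2[OF 2]] _ order_refl] order_refl])
        fix s3 assume 3: "unchanged {5, 6} {3, V} s2 s3 \<and> (\<forall>x<n. rmem s3 V x = game_value G i E x)"
        have u3: "unchanged ?A ?B s s3"
          by (rule unchanged_trans[OF u2 conjunct1[OF 3]]) auto
        have cap3: "rmem s3 2 0 = cap G i"
          using cap2 unchanged_rmem[OF conjunct1[OF 3], of 2] neq by simp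
        have N3: "?N s3" using N2 unchanged_nmem[OF conjunct1[OF 3], of N] neq by simp
        show "runs (select_arcs i R V N) s3 (6 * m + 2)
          (\<lambda>s'. unchanged ?A ?B s s' \<and> rmem s' 2 0 = cap G i \<and>
            (\<forall>x<n. rmem s' V x = game_value G i E x) \<and> greedy G i E (game_value G i E) (nmem s' N))"
        proof (rule runs_mono[OF select_arcs_correct[OF input'[OF u3] V E'[OF u3] E(2) conjunct2[OF 3] N3] _ order_refl])
          fix s4 assume 4: "unchanged {6, N} {} s3 s4 \<and> greedy G i E (game_value G i E) (nmem s4 N)"
          have "unchanged ?A ?B s s4"
            by (rule unchanged_trans[OF u3 conjunct1[OF 4]]) auto
          moreover have "rmem s4 a = rmem s3 a" for a using 4 by (simp add: unchanged_def)
          ultimately show "unchanged ?A ?B s s4 \<and> rmem s4 2 0 = cap G i \<and>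
            (\<forall>x<n. rmem s4 V x = game_value G i E x) \<and> greedy G i E (game_value G i E) (nmem s4 N)"
            using 3 4 cap3 by simp
        qed
      qed
    qed
  qed
qed

section \<open>Assembling the equilibrium\<close>

lemma fix_arcs_correct:
  assumes input: "holds_input G s" and N: "N \<in> {8, 9}" and zero: "\<forall>x. nmem s 7 x = 0"
  shows "runs (fix_arcs q N) s (5 * n + 2)
    (\<lambda>s'. unchanged {4, 6, 7} {} s s' \<and>
      (\<forall>x<n. nmem s' 4 x = nmem s N x \<and> nmem s' 7 x = (if x \<in> ctrl G q then Suc (nmem s N x) else 0)))"
proof -
  define I where "I k s' \<longleftrightarrow> unchanged {4, 6, 7} {} s s' \<and>
    (\<forall>x<k. nmem s' 4 x = nmem s N x \<and> nmem s' 7 x = (if x \<in> ctrl G q then Suc (nmem s N x) else 0)) \<and>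
    (\<forall>x. k \<le> x \<longrightarrow> nmem s' 7 x = 0)" for k s'
  have input': "holds_input G s'" if "unchanged {4, 6, 7} {} s s'" for s'
    by (rule holds_input_unchanged[OF input that]) auto
  have neq: "N \<noteq> 4" "N \<noteq> 6" "N \<noteq> 7" using N by auto
  show ?thesis
    unfolding fix_arcs_def
  proof (rule runs_for_loop[where I = I and N = n and T = 3])
    show "nval vert_count s' = n" if "I k s'" for k s'
      using that input' by (simp add: I_def input_counts)
  next
    fix k s'
    assume k: "k < n" and I: "I k s'" and ctr: "nmem s' 6 0 = k"
    have u: "unchanged {4, 6, 7} {} s s'" using I by (simp add: I_def)
    have N': "nmem s' N = nmem s N" using unchanged_nmem[OF u] neq by simp
    let ?c = "Seq (NAssign 4 (ncell 6) (NRead N (ncell 6)))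
         (Cond (NEq (NRead 1 (ncell 6)) (NConst (code q)))
           (NAssign 7 (ncell 6) (NAdd (NRead N (ncell 6)) (NConst 1))) Skip)"
    have eff: "effect ?c s' =
       (if k \<in> ctrl G q then nwrite 7 k (Suc (nmem s N k)) (nwrite 4 k (nmem s N k) s')
        else nwrite 4 k (nmem s N k) s')"
      using input_owner(1)[OF input'[OF u] k, of q] neq by (simp add: ctr N')
    show "runs ?c s' 3 (\<lambda>s'. nmem s' 6 0 = k \<and> I (Suc k) (nwrite 6 0 (Suc k) s'))"
      by (rule runs_loop_free) (use I ctr neq in \<open>unfold eff, auto simp: I_def less_Suc_eq\<close>)
  qed (use zero in \<open>auto simp: I_def unchanged_refl\<close>)
qed

lemma follow_path_correct:
  assumes input: "holds_input G s"
    and sit: "situation G (\<lambda>_. b)" and b: "b = nmem s 10" and a: "\<forall>x<n. nmem s 4 x = a x"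
    and ab: "\<And>x. x < n \<Longrightarrow> x \<notin> terminals G \<Longrightarrow> x \<notin> ctrl G p \<Longrightarrow> b x = a x"
  shows "runs (follow_path p) s (6 * n + 3)
    (\<lambda>s'. \<forall>x<n. nmem s' 4 x = (if x \<in> ctrl G p \<and> (\<exists>k. x = play G (\<lambda>_. b) k) then b x else a x))"
proof -
  define I where "I k s' \<longleftrightarrow> unchanged {4, 6, 11} {} s s' \<and> nmem s' 11 0 = play G (\<lambda>_. b) k \<and>
    (\<forall>x<n. nmem s' 4 x = (if x \<in> ctrl G p \<and> (\<exists>j<k. x = play G (\<lambda>_. b) j) then b x else a x))" for k s'
  have input': "holds_input G s'" if "unchanged {4, 6, 11} {} s s'" for s'
    by (rule holds_input_unchanged[OF input that]) auto
  \<comment> \<open>The loop makes only \<open>n\<close> rounds, while membership in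
    \<open>P\<close> quantifies over all times; every vertex of the play has already appeared by
    then.\<close>
  have early: "(\<exists>k. x = play G (\<lambda>_. b) k) \<longleftrightarrow> (\<exists>k<n. x = play G (\<lambda>_. b) k)" for x
    using play_early[OF sit] by metis
  show ?thesis
    unfolding follow_path_def
  proof (rule runs_Seq[where T = 1 and T' = "6 * n + 2"], rule runs_loop_free)
    show "runs (for_loop 6 vert_count
         (Cond (NEq (NRead 1 (ncell 11)) (NConst 0)) Skip
           (Seq
             (Cond (NEq (NRead 1 (ncell 11)) (NConst (code p)))
               (NAssign 4 (ncell 11) (NRead 10 (ncell 11))) Skip)
             (NAssign 11 (NConst 0) (NRead 3 (NRead 4 (ncell 11)))))))
       (effect (NAssign 11 (NConst 0) (NRead 0 (NConst 2))) s) (6 * n + 2)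
       (\<lambda>s'. \<forall>x<n. nmem s' 4 x = (if x \<in> ctrl G p \<and> (\<exists>k. x = play G (\<lambda>_. b) k) then b x else a x))"
    proof (rule runs_for_loop[where I = I and N = n and T = 4])
      show "I 0 (nwrite 6 0 0 (effect (NAssign 11 (NConst 0) (NRead 0 (NConst 2))) s))"
        using a by (simp add: I_def unchanged_refl input_counts(3)[OF input])
      show "nval vert_count s' = n" if "I k s'" for k s'
        using that input' by (simp add: I_def input_counts)
      show "I n s' \<Longrightarrow> \<forall>x<n. nmem s' 4 x =
          (if x \<in> ctrl G p \<and> (\<exists>k. x = play G (\<lambda>_. b) k) then b x else a x)" for s'
        unfolding early by (simp add: I_def)
    next
      fix k s'
      assume k: "k < n" and I: "I k s'" and ctr: "nmem s' 6 0 = k"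
      have u: "unchanged {4, 6, 11} {} s s'" using I by (simp add: I_def)
      note inp = input'[OF u]
      let ?x = "play G (\<lambda>_. b) k"
      let ?c = "Cond (NEq (NRead 1 (ncell 11)) (NConst 0)) Skip
             (Seq
               (Cond (NEq (NRead 1 (ncell 11)) (NConst (code p)))
                 (NAssign 4 (ncell 11) (NRead 10 (ncell 11))) Skip)
               (NAssign 11 (NConst 0) (NRead 3 (NRead 4 (ncell 11)))))"
      have cur: "nmem s' 11 0 = ?x" using I by (simp add: I_def)
      have x: "?x \<in> verts (graph G)" "?x < n" using play_vert[OF sit, of k] by (simp_all add: verts_eq)
      have b': "nmem s' 10 = b" using unchanged_nmem[OF u, of 10] b by simp
      show "runs ?c s' 4 (\<lambda>s'. nmem s' 6 0 = k \<and> I (Suc k) (nwrite 6 0 (Suc k) s'))"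
      proof (cases "?x \<in> terminals G")
        case True
        then have "effect ?c s' = s'" using input_owner(2)[OF inp x(2)] by (simp add: cur)
        moreover have "?x \<notin> ctrl G p" using True ctrl_vert by blast
        ultimately show ?thesis
          by (intro runs_loop_free) (use I ctr True in \<open>auto simp: I_def less_Suc_eq\<close>)
      next
        case False
        have arc: "b ?x < m" using chosen_arc_out(1)[OF sit x(1) False] by (simp add: chosen_arc_def arcs_eq)
        \<comment> \<open>Off the vertices of \<open>p\<close>, array 4 still holds
          \<open>a\<close>, which coincides with \<open>b\<close> there; so the walk really follows
          \<open>b\<close>.\<close>
        have old: "?x \<notin> ctrl G p \<Longrightarrow> nmem s' 4 ?x = b ?x" using I x(2) ab[OF x(2) False] by (simp add: I_def)
        have eff: "effect ?c s' =
           (let s'' = if ?x \<in> ctrl G p then nwrite 4 ?x (b ?x) s' else s' in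
             nwrite 11 0 (head (graph G) (b ?x)) s'')"
          using input_owner[OF inp x(2)] False old
          by (simp add: cur b' input_arc[OF inp arc] Let_def)
        have next': "play G (\<lambda>_. b) (Suc k) = head (graph G) (b ?x)"
          using play_step[OF False] unfolding chosen_arc_def by simp
        show ?thesis
          by (rule runs_loop_free)
            (use I ctr in \<open>unfold eff, auto simp: I_def less_Suc_eq next' Let_def simp del: play.simps(2)\<close>)
      qed
    qed simp
  qed simp_all
qed

lemma path_equilibrium_correct:
  fixes q :: player and s :: store and N :: nat
  defines "v \<equiv> game_value G q (arcs (graph G))" and "a \<equiv> nmem s N"
  assumes input: "holds_input G s" and N: "N \<in> {8, 9}" and zero: "\<forall>x. nmem s 7 x = 0"
    and a: "greedy G q (arcs (graph G)) v a" and val: "v (init G) < cap G q"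
  shows "runs (path_equilibrium q N) s (40 * (n + m + 1) ^ 2) (\<lambda>s'. nash_equilibrium G (output_situation s'))"
proof -
  let ?p = "opponent q" and ?S = "20 * (n + m + 1) ^ 2" and ?E = "restricted q a"
  have time: "5 * n + 2 + (?S + (6 * n + 3)) \<le> 40 * (n + m + 1) ^ 2"
    by (simp add: power2_eq_square algebra_simps)
  show ?thesis
    unfolding path_equilibrium_def
  proof (rule runs_Seq[OF runs_mono[OF fix_arcs_correct[OF input N zero, of q] _ order_refl] time])
    fix s1 assume 1: "unchanged {4, 6, 7} {} s s1 \<and>
      (\<forall>x<n. nmem s1 4 x = nmem s N x \<and> nmem s1 7 x = (if x \<in> ctrl G q then Suc (nmem s N x) else 0))"
    have input1: "holds_input G s1" by (rule holds_input_unchanged[OF input conjunct1[OF 1]]) auto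
    \<comment> \<open>The shift by one in array 7 lets 0 mean that a vertex is unrestricted, so arc
      0 can be fixed too. This is where the entries not written by \<open>fix_arcs\<close> have to
      be 0.\<close>
    have E: "?E = permitted_arcs G 7 s1"
    proof -
      have "nmem s1 7 (tail (graph G) e) \<in> {0, Suc e} \<longleftrightarrow>
          (tail (graph G) e \<in> ctrl G q \<longrightarrow> e = a (tail (graph G) e))" if "e < m" for e
      proof -
        have "nmem s1 7 (tail (graph G) e) = (if tail (graph G) e \<in> ctrl G q then Suc (a (tail (graph G) e)) else 0)"
          using 1 tail_less[OF that] by (simp add: a_def)
        then show ?thesis by auto
      qed
      then show ?thesis unfolding restricted_def permitted_arcs_def using arcs_eq by blast
    qed
    show "runs (Seq (solve ?p 7 6 10) (follow_path ?p)) s1 (?S + (6 * n + 3))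
      (\<lambda>s'. nash_equilibrium G (output_situation s'))"
    proof (rule runs_Seq[OF runs_mono[OF solve_correct[OF input1 _ _ _ E admissible_restricted[OF a], of 6 10 ?p] _ order_refl] order_refl])
      fix s2 assume 2: "unchanged {5, 6, 10} {2, 3, 6} s1 s2 \<and> rmem s2 2 0 = cap G ?p \<and>
        (\<forall>x<n. rmem s2 6 x = game_value G ?p ?E x) \<and> greedy G ?p ?E (game_value G ?p ?E) (nmem s2 10)"
      define b where "b = nmem s2 10"
      have input2: "holds_input G s2" by (rule holds_input_unchanged[OF input1 conjunct1[OF 2]]) auto
      have b: "greedy G ?p ?E (game_value G ?p ?E) b" using 2 by (simp add: b_def)
      have a2: "\<forall>x<n. nmem s2 4 x = a x"
        using 1 unchanged_nmem[OF conjunct1[OF 2], of 4] by (simp add: a_def)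
      have b_E: "b x \<in> ?E \<and> tail (graph G) (b x) = x" if "x \<in> verts (graph G)" "x \<notin> terminals G" for x
        using b that by (simp add: greedy_def)
      have sit: "situation G (\<lambda>_. b)"
        using b_E ctrl_vert by (intro situation_outI) (auto simp: restricted_def)
      have ab: "b x = a x" if "x < n" "x \<notin> terminals G" "x \<notin> ctrl G ?p" for x
      proof -
        have x: "x \<in> verts (graph G)" using that by (simp add: verts_eq)
        then have "x \<in> ctrl G q" using ctrl_cases[OF x that(2), of q] that(3) by blast
        then show ?thesis using b_E[OF x that(2)] by (auto simp: restricted_def)
      qed
      show "runs (follow_path ?p) s2 (6 * n + 3) (\<lambda>s'. nash_equilibrium G (output_situation s'))"
      proof (rule runs_mono[OF follow_path_correct[OF input2 sit b_def a2 ab] _ order_refl])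
        fix s3 :: store
        assume 3: "\<forall>x<n. nmem s3 4 x =
          (if x \<in> ctrl G ?p \<and> (\<exists>k. x = play G (\<lambda>_. b) k) then b x else a x)"
        show "nash_equilibrium G (output_situation s3)"
        proof (rule nash_shortest_path[OF a[unfolded v_def] val[unfolded v_def] b])
          fix x assume x: "x \<in> ctrl G q"
          then show "output_situation s3 q x = a x"
            using 3 ctrl_opponent[of x q] ctrl_vert[OF x] by (auto simp: output_situation_def verts_eq)
        next
          fix x assume x: "x \<in> ctrl G ?p"
          then show "output_situation s3 ?p x = (if \<exists>k. x = play G (\<lambda>_. b) k then b x else a x)"
            using 3 ctrl_vert[OF x] by (auto simp: output_situation_def verts_eq)
        qed
      qed
    qed simp_all
  qed
qed

lemma blocked_equilibrium_correct:
  assumes input: "holds_input G s"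
    and a: "\<And>i. greedy G i (arcs (graph G)) (game_value G i (arcs (graph G)))
      (nmem s (case i of P1 \<Rightarrow> 8 | P2 \<Rightarrow> 9))"
    and val: "\<And>i. game_value G i (arcs (graph G)) (init G) = cap G i"
  shows "runs blocked_equilibrium s (4 * n + 2) (\<lambda>s'. nash_equilibrium G (output_situation s'))"
proof -
  define I where "I k s' \<longleftrightarrow> unchanged {4, 6} {} s s' \<and>
    (\<forall>x<k. nmem s' 4 x = (if x \<in> ctrl G P1 then nmem s 9 x else nmem s 8 x))" for k s'
  have input': "holds_input G s'" if "unchanged {4, 6} {} s s'" for s'
    by (rule holds_input_unchanged[OF input that]) auto
  show ?thesis
    unfolding blocked_equilibrium_def
  proof (rule runs_for_loop[where I = I and N = n and T = 2])
    show "nval vert_count s' = n" if "I k s'" for k s'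
      using that input' by (simp add: I_def input_counts)
  next
    fix k s'
    assume k: "k < n" and I: "I k s'" and ctr: "nmem s' 6 0 = k"
    have u: "unchanged {4, 6} {} s s'" using I by (simp add: I_def)
    have N': "nmem s' 8 = nmem s 8" "nmem s' 9 = nmem s 9" using unchanged_nmem[OF u] by simp_all
    let ?c = "Cond (NEq (NRead 1 (ncell 6)) (NConst (code P1)))
         (NAssign 4 (ncell 6) (NRead 9 (ncell 6))) (NAssign 4 (ncell 6) (NRead 8 (ncell 6)))"
    have eff: "effect ?c s' = nwrite 4 k (if k \<in> ctrl G P1 then nmem s 9 k else nmem s 8 k) s'"
      using input_owner(1)[OF input'[OF u] k, of P1] by (simp add: ctr N')
    show "runs ?c s' 2 (\<lambda>s'. nmem s' 6 0 = k \<and> I (Suc k) (nwrite 6 0 (Suc k) s'))"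
      by (rule runs_loop_free) (use I ctr in \<open>unfold eff, auto simp: I_def less_Suc_eq\<close>)
  next
    fix s' assume I: "I n s'"
    show "nash_equilibrium G (output_situation s')"
    proof (rule nash_if_both_blocked[OF a val])
      fix i x assume x: "x \<in> ctrl G i"
      then show "output_situation s' i x = nmem s (case opponent i of P1 \<Rightarrow> 8 | P2 \<Rightarrow> 9) x"
        using I ctrl_vert[OF x] ctrl_opponent[of x P1]
        by (cases i) (auto simp: output_situation_def opponent_def I_def verts_eq)
    qed
  qed (auto simp: I_def unchanged_refl)
qed

lemma permitted_all:
  "nmem s R = (\<lambda>_. 0) \<Longrightarrow> arcs (graph G) = permitted_arcs G R s"
  by (auto simp: permitted_arcs_def)

lemma equilibrium_program_correct:
  "runs equilibrium_program (game_input G) (100 * (n + m + 1) ^ 2)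
    (\<lambda>s'. nash_equilibrium G (output_situation s'))"
proof -
  let ?S = "20 * (n + m + 1) ^ 2" and ?E = "arcs (graph G)"
  let ?v = "\<lambda>i. game_value G i ?E" and ?Q = "\<lambda>s'. nash_equilibrium G (output_situation s')"
  \<comment> \<open>The worst branch makes two zero-sum calls at 20 each and one path construction
    at 40; the rest of the 100 absorbs the tests and additive constants.\<close>
  have time: "?S + (61 * (n + m + 1) ^ 2 + 3) \<le> 100 * (n + m + 1) ^ 2"
    "Suc (60 * (n + m + 1) ^ 2 + 3) \<le> 61 * (n + m + 1) ^ 2 + 3"
    "?S + (40 * (n + m + 1) ^ 2 + 1) \<le> 60 * (n + m + 1) ^ 2 + 3"
    "4 * n + 2 \<le> 40 * (n + m + 1) ^ 2"
    "40 * (n + m + 1) ^ 2 \<le> 60 * (n + m + 1) ^ 2 + 3"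
    by (simp_all add: power2_eq_square algebra_simps)
  let ?s0 = "game_input G"
  have input0: "holds_input G ?s0" by (simp add: holds_input_def)
  \<comment> \<open>The initially blank memory provides the empty restriction in array 12 and the
    clean array 7 that \<open>fix_arcs\<close> relies on.\<close>
  have zero0: "nmem ?s0 7 = (\<lambda>_. 0)" "nmem ?s0 12 = (\<lambda>_. 0)"
    by (auto simp: game_input_def Let_def)
  have init: "init G < n" using init_vert by (simp add: verts_eq)
  show ?thesis
    unfolding equilibrium_program_def
  proof (rule runs_Seq[OF runs_mono[OF solve_correct[OF input0 _ _ _ permitted_all[OF zero0(2)] admissible_arcs, of 4 8 P1] _ order_refl] time(1)])
    fix s1 assume 1: "unchanged {5, 6, 8} {2, 3, 4} ?s0 s1 \<and> rmem s1 2 0 = cap G P1 \<and>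
      (\<forall>x<n. rmem s1 4 x = ?v P1 x) \<and> greedy G P1 ?E (?v P1) (nmem s1 8)"
    have input1: "holds_input G s1" by (rule holds_input_unchanged[OF input0 conjunct1[OF 1]]) auto
    have zero1: "nmem s1 7 = (\<lambda>_. 0)" "nmem s1 12 = (\<lambda>_. 0)"
      using unchanged_nmem[OF conjunct1[OF 1]] zero0 by simp_all
    have test1: "bval (RLess (RRead 4 (NRead 0 (NConst 2))) cap_cell) s1 \<longleftrightarrow> ?v P1 (init G) < cap G P1"
      using 1 init by (simp add: input_counts(3)[OF input1])
    show "runs (Cond (RLess (RRead 4 (NRead 0 (NConst 2))) cap_cell) (path_equilibrium P1 8)
         (Seq (solve P2 12 5 9)
           (Cond (RLess (RRead 5 (NRead 0 (NConst 2))) cap_cell) (path_equilibrium P2 9)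
             blocked_equilibrium))) s1 (61 * (n + m + 1) ^ 2 + 3) ?Q"
    proof (rule runs_Cond[OF _ _ time(2)], unfold test1)
      assume "?v P1 (init G) < cap G P1"
      then show "runs (path_equilibrium P1 8) s1 (60 * (n + m + 1) ^ 2 + 3) ?Q"
        using runs_mono[OF path_equilibrium_correct[OF input1, of 8 P1] _ time(5)] 1 zero1 by simp
    next
      assume not1: "\<not> ?v P1 (init G) < cap G P1"
      show "runs (Seq (solve P2 12 5 9)
           (Cond (RLess (RRead 5 (NRead 0 (NConst 2))) cap_cell) (path_equilibrium P2 9)
             blocked_equilibrium)) s1 (60 * (n + m + 1) ^ 2 + 3) ?Q"
      proof (rule runs_Seq[OF runs_mono[OF solve_correct[OF input1 _ _ _ permitted_all[OF zero1(2)] admissible_arcs, of 5 9 P2] _ order_refl] time(3)])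
        fix s2 assume 2: "unchanged {5, 6, 9} {2, 3, 5} s1 s2 \<and> rmem s2 2 0 = cap G P2 \<and>
          (\<forall>x<n. rmem s2 5 x = ?v P2 x) \<and> greedy G P2 ?E (?v P2) (nmem s2 9)"
        have input2: "holds_input G s2" by (rule holds_input_unchanged[OF input1 conjunct1[OF 2]]) auto
        have mem2: "nmem s2 7 = (\<lambda>_. 0)" "nmem s2 8 = nmem s1 8"
          using unchanged_nmem[OF conjunct1[OF 2]] zero1 by simp_all
        have test2: "bval (RLess (RRead 5 (NRead 0 (NConst 2))) cap_cell) s2 \<longleftrightarrow> ?v P2 (init G) < cap G P2"
          using 2 init by (simp add: input_counts(3)[OF input2])
        show "runs (Cond (RLess (RRead 5 (NRead 0 (NConst 2))) cap_cell) (path_equilibrium P2 9)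
             blocked_equilibrium) s2 (40 * (n + m + 1) ^ 2 + 1) ?Q"
        proof (rule runs_Cond[where T = "40 * (n + m + 1) ^ 2"], unfold test2)
          assume "?v P2 (init G) < cap G P2"
          then show "runs (path_equilibrium P2 9) s2 (40 * (n + m + 1) ^ 2) ?Q"
            using path_equilibrium_correct[OF input2, of 9 P2] 2 mem2 by simp
        next
          assume not2: "\<not> ?v P2 (init G) < cap G P2"
          have val: "?v i (init G) = cap G i" for i
            using not1 not2 game_value_le_cap[OF order_refl, of i "init G"]
            by (cases i) auto
          have a: "greedy G i ?E (?v i) (nmem s2 (case i of P1 \<Rightarrow> 8 | P2 \<Rightarrow> 9))" for i
            using 1 2 mem2 by (cases i) simp_all
          show "runs blocked_equilibrium s2 (40 * (n + m + 1) ^ 2) ?Q"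
            by (rule runs_mono[OF blocked_equilibrium_correct[OF input2 a val] _ time(4)])
        qed simp
      qed simp_all
    qed
  qed simp_all
qed

end

theorem theorem1:
  shows "(\<forall>G :: ('v, 'e) sp_game. positive_sp_game G \<longrightarrow> (\<exists>\<sigma>. nash_equilibrium G \<sigma>)) \<and>
    poly_time_solvable {G :: (nat, nat) sp_game. positive_sp_game G \<and> numbered G}
      game_size game_input (\<lambda>G s. nash_equilibrium G (output_situation s))"
proof
  show "\<forall>G :: ('v, 'e) sp_game. positive_sp_game G \<longrightarrow> (\<exists>\<sigma>. nash_equilibrium G \<sigma>)"
    using positive_game.ex_nash_equilibrium positive_game.intro by blast
  \<comment> \<open>This is \<open>100 * (1 + X) ^ 2\<close>; evaluated at the size
    \<open>n + m\<close> it is exactly the bound shown for the program.\<close>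
  let ?p = "[:100:] * [:1, 1:] ^ 2 :: nat poly"
  show "poly_time_solvable {G :: (nat, nat) sp_game. positive_sp_game G \<and> numbered G}
      game_size game_input (\<lambda>G s. nash_equilibrium G (output_situation s))"
    unfolding poly_time_solvable_def
  proof (intro exI[of _ equilibrium_program] exI[of _ ?p] ballI)
    fix G :: "(nat, nat) sp_game"
    assume "G \<in> {G. positive_sp_game G \<and> numbered G}"
    then interpret numbered_game G
      by (simp add: numbered_game_def positive_game_def numbered_game_axioms_def)
    have "poly ?p (game_size G) = 100 * (n + m + 1) ^ 2"
      by (simp add: game_size_def add.commute)
    then show "\<exists>t s. exec equilibrium_program (game_input G) t s \<and> t \<le> poly ?p (game_size G) \<and>
        nash_equilibrium G (output_situation s)"
      using equilibrium_program_correct unfolding runs_def by simp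
  qed
qed

end
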